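(* Let $(X_t)_{t\ge 0}$ be an irreducible, nonexplosive, positive recurrent birth--death process on $\mathbb{N}$ with birth rates $\lambda$, death rates $\nu$ and stationary distribution $\mu$. Let $\rho:\mathbb{N}\to(0,\infty)$ be increasing with $\rho\in\mathcal{D}(\mathcal{E}_\mu)$, $u_x=\rho(x+1)-\rho(x)$, $d_u(x,y)=|\rho(x)-\rho(y)|$, and assume that $V_u$ is bounded from below and that $$\kappa_u:=\int_0^\infty\sup_{x\in\mathbb{N}}\mathbb{E}_x\left[\exp\left(-\int_0^tV_u(X_{u,s})\,ds\right)\right]dt<\infty.$$ Then the weighted isoperimetric inequality holds with constant $h_u=1/\kappa_u$: for every probability measure $\pi$ absolutely continuous with respect to $\mu$ with density $f\in\mathcal{D}(\mathcal{E}_\mu)$, $$\frac1{\kappa_u}\,\mathcal{W}_{d_u}(\pi,\mu)\le\int_{\mathbb{N}}\lambda\,u\,|\partial f|\,d\mu.$$ If moreover there exist two constants $\varepsilon>0$ and $\theta>1$ such that $$(1+\varepsilon)\lambda_xu_x^2+(1+1/\varepsilon)\nu_xu_{x-1}^2\le-a\left(\lambda_x(\theta-1)+\nu_x(1/\theta-1)\right)+b,\qquad x\in\mathbb{N},$$ where $a=a_{\varepsilon,\theta}\ge0$ and $b=b_{\varepsilon,\theta}>0$ are two other constants depending on both $\varepsilon$ and $\theta$, then the transportation-information inequality $$\alpha(\mathcal{W}_{d_u}(\pi,\mu))\le\mathcal{I}(\pi,\mu)$$ holds for every probability measure $\pi$ absolutely continuous with respect to $\mu$, with deviation function $$\alpha(r)=\sup_{\varepsilon>0,\,\theta>1}\frac{\sqrt{b^2+2a(r/\kappa_u)^2}-b}{2a},$$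 the supremum being over the $\varepsilon,\theta$ (with their constants $a,b$) for which the preceding inequality holds.
   Context: $\mathbb{N}=\{0,1,2,\dots\}$. A birth--death process $(X_t)_{t\ge0}$ with birth rates $\lambda_x$ and death rates $\nu_x$ is the continuous-time Markov chain on $\mathbb{N}$ with generator $\mathcal{L}f(x)=\lambda_x\,\partial f(x)+\nu_x\,\partial^* f(x)$, where $\partial f(x)=f(x+1)-f(x)$, $\partial^*f(x)=f(x-1)-f(x)$; $P_t^x$ denotes the law of $X_t$ started at $x$. Irreducible means $\lambda_x>0$ for all $x\in\mathbb{N}$, $\nu_x>0$ for all $x\ge1$ and $\nu_0=0$. Nonexplosive means $\sum_{x\ge1}\left(\frac1{\lambda_x}+\frac{\nu_x}{\lambda_x\lambda_{x-1}}+\cdots+\frac{\nu_x\cdots\nu_1}{\lambda_x\cdots\lambda_1\lambda_0}\right)=\infty$. Positive recurrent means $\sum_{x\ge1}\frac{\lambda_0\cdots\lambda_{x-1}}{\nu_1\cdots\nu_x}<\infty$; the stationary distribution is then $\mu(x)=\mu(0)\prod_{y=1}^x\frac{\lambda_{y-1}}{\nu_y}$ with $\mu(0)$ the normalizing constant. The Dirichlet form is $\mathcal{E}_\mu(f,g)=\int_{\mathbb{N}}\lambda\,\partial f\,\partial g\,d\mu$, with domain $\mathcal{D}(\mathcal{E}_\mu)=\{f\in L^2(\mu):\mathcal{E}_\mu(f,f)<\infty\}$. For $\pi\ll\mu$ with density $f$, the Fisher--Donsker--Varadhan information is $\mathcal{I}(\pi,\mu)=\mathcal{E}_\mu(\sqrt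 f,\sqrt f)$ if $\sqrt f\in\mathcal{D}(\mathcal{E}_\mu)$ and $\mathcal{I}(\pi,\mu)=\infty$ otherwise. The Wasserstein distance is $\mathcal{W}_{d_u}(\mu_1,\mu_2)=\inf_\gamma\int\int d_u(x,y)\,\gamma(dx,dy)$, the infimum being over probability measures $\gamma$ on $\mathbb{N}^2$ with marginals $\mu_1,\mu_2$. The $u$-modification $(X_{u,t})_{t\ge0}$ is the (minimal) birth--death process with birth rates $\lambda^u_x=\frac{u_{x+1}}{u_x}\lambda_{x+1}$ and death rates $\nu^u_x=\frac{u_{x-1}}{u_x}\nu_x$ (so $\nu^u_0=0$), with semigroup $P_{u,t}g(x)=\mathbb{E}_x[g(X_{u,t})]$ (quantities being taken equal to $0$ after a possible explosion). The potential is $V_u(x)=\nu_{x+1}-\nu^u_x+\lambda_x-\lambda^u_x$. Terms $\nu_xu_{x-1}^2$ are $0$ at $x=0$. When $a=0$ the expression defining $\alpha$ is understood as its limit $a\to0^+$. Standing assumptions: $\lambda^u$, $\nu^u$, $V_u$ are $P_{u,t}$-integrable, i.e. $P_{u,t}(\lambda^u+\nu^u+|V_u|)(x)<\infty$ for all $x,t$; and $\sum_{y}d_u(y,x_0)P_t^x(y)<\infty$ for all $x,x_0\in\mathbb{N}$, $t\ge0$. *)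

theory Defs
  imports "HOL-Probability.Probability"
begin

definition bd_irreducible :: "(nat \<Rightarrow> real) \<Rightarrow> (nat \<Rightarrow> real) \<Rightarrow> bool" where
  "bd_irreducible lam nu \<longleftrightarrow> (\<forall>x. 0 < lam x) \<and> (\<forall>x\<ge>1. 0 < nu x) \<and> nu 0 = 0"

text \<open>The series runs over \<open>x \<ge> 1\<close>; its terms are positive for irreducible rates, so
  divergence to infinity is non-summability. The summand of index \<open>k\<close> is
  \<open>nu x \<cdots> nu (k+1) / (lam x \<cdots> lam k)\<close>.\<close>

definition bd_nonexplosive :: "(nat \<Rightarrow> real) \<Rightarrow> (nat \<Rightarrow> real) \<Rightarrow> bool" where
  "bd_nonexplosive lam nu \<longleftrightarrow>
    \<not> summable (\<lambda>n. let x = Suc n in \<Sum>k\<le>x. (\<Prod>j=k+1..x. nu j) / (\<Prod>j=k..x. lam j))"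

definition bd_weight :: "(nat \<Rightarrow> real) \<Rightarrow> (nat \<Rightarrow> real) \<Rightarrow> nat \<Rightarrow> real" where
  "bd_weight lam nu x = (\<Prod>y=1..x. lam (y - 1) / nu y)"

definition bd_positive_recurrent :: "(nat \<Rightarrow> real) \<Rightarrow> (nat \<Rightarrow> real) \<Rightarrow> bool" where
  "bd_positive_recurrent lam nu \<longleftrightarrow> summable (\<lambda>n. bd_weight lam nu (Suc n))"

text \<open>Meaningful for irreducible positive recurrent rates only.\<close>

definition bd_stationary :: "(nat \<Rightarrow> real) \<Rightarrow> (nat \<Rightarrow> real) \<Rightarrow> nat pmf" where
  "bd_stationary lam nu = embed_pmf (\<lambda>x. bd_weight lam nu x / (\<Sum>y. bd_weight lam nu y))"

lemma pmf_bd_stationary: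
  assumes "bd_irreducible lam nu" "bd_positive_recurrent lam nu"
  shows "pmf (bd_stationary lam nu) x = bd_weight lam nu x / (\<Sum>y. bd_weight lam nu y)"
proof -
  let ?w = "bd_weight lam nu"
  have pos: "0 < ?w y" for y
    using assms(1) by (auto simp: bd_weight_def bd_irreducible_def intro!: prod_pos)
  have s: "summable ?w"
    using assms(2) by (simp add: bd_positive_recurrent_def summable_Suc_iff)
  have Z: "0 < (\<Sum>y. ?w y)"
    using suminf_pos[OF s] pos by blast
  have "(\<lambda>y. ?w y / (\<Sum>y. ?w y)) sums ((\<Sum>y. ?w y) / (\<Sum>y. ?w y))"
    using s by (intro sums_divide) (rule summable_sums)
  hence "(\<Sum>y. ennreal (?w y / (\<Sum>y. ?w y))) = ennreal 1"
    using Z pos by (intro suminf_ennreal_eq) (auto intro!: less_imp_le)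
  hence "(\<integral>\<^sup>+ y. ennreal (?w y / (\<Sum>y. ?w y)) \<partial>count_space UNIV) = 1"
    by (simp add: nn_integral_count_space_nat)
  thus ?thesis
    unfolding bd_stationary_def using Z pos by (intro pmf_embed_pmf) (auto intro!: less_imp_le)
qed

text \<open>
  The minimal chain with generator \<open>f \<mapsto> b x (f (x+1) - f x) + d x (f (x-1) - f x)\<close> is realised
  by its jump chain and holding times on a canonical space carrying i.i.d. pairs of a
  standard exponential clock and an independent uniform variable. In state \<open>y\<close> the chain waits
  for the clock divided by \<open>b y + d y\<close>, i.e. an exponential time of rate \<open>b y + d y\<close>, and then
  goes up with probability \<open>b y / (b y + d y)\<close>, down otherwise. Rates must satisfy
  \<open>0 < b y\<close>, \<open>0 \<le> d y\<close> and \<open>d 0 = 0\<close>. The state is \<open>None\<close> from the explosion time on.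
\<close>

definition bd_noise :: "(nat \<Rightarrow> real \<times> real) measure" where
  "bd_noise = (\<Pi>\<^sub>M n\<in>UNIV. density lborel (\<lambda>x. ennreal (exponential_density 1 x))
                         \<Otimes>\<^sub>M uniform_measure lborel {0..1})"

lemma prob_space_bd_noise: "prob_space bd_noise"
  unfolding bd_noise_def
  by (intro prob_space_PiM prob_space_pair prob_space_exponential_density
        prob_space_uniform_measure) auto

primrec bd_jump_chain ::
  "(nat \<Rightarrow> real) \<Rightarrow> (nat \<Rightarrow> real) \<Rightarrow> nat \<Rightarrow> (nat \<Rightarrow> real \<times> real) \<Rightarrow> nat \<Rightarrow> nat" where
  "bd_jump_chain b d x w 0 = x"
| "bd_jump_chain b d x w (Suc n) =
     (let y = bd_jump_chain b d x w n
      in if snd (w n) * (b y + d y) < b y then y + 1 else y - 1)"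

definition bd_jump_time ::
  "(nat \<Rightarrow> real) \<Rightarrow> (nat \<Rightarrow> real) \<Rightarrow> nat \<Rightarrow> (nat \<Rightarrow> real \<times> real) \<Rightarrow> nat \<Rightarrow> real" where
  "bd_jump_time b d x w n =
     (\<Sum>k<n. let y = bd_jump_chain b d x w k in fst (w k) / (b y + d y))"

definition bd_path ::
  "(nat \<Rightarrow> real) \<Rightarrow> (nat \<Rightarrow> real) \<Rightarrow> nat \<Rightarrow> real \<Rightarrow> (nat \<Rightarrow> real \<times> real) \<Rightarrow> nat option" where
  "bd_path b d x t w =
     (if \<exists>n. t < bd_jump_time b d x w (Suc n)
      then Some (bd_jump_chain b d x w (LEAST n. t < bd_jump_time b d x w (Suc n)))
      else None)"

definition bd_trans :: "(nat \<Rightarrow> real) \<Rightarrow> (nat \<Rightarrow> real) \<Rightarrow> real \<Rightarrow> nat \<Rightarrow> nat \<Rightarrow> real" where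
  "bd_trans b d t x y = measure bd_noise {w \<in> space bd_noise. bd_path b d x t w = Some y}"

text \<open>Functions on the state space are extended by \<open>0\<close> to the exploded state. The semigroup
  is only needed on nonnegative functions, so it takes values in \<open>[0,\<infinity>]\<close>.\<close>

definition bd_semigroup ::
  "(nat \<Rightarrow> real) \<Rightarrow> (nat \<Rightarrow> real) \<Rightarrow> real \<Rightarrow> (nat \<Rightarrow> real) \<Rightarrow> nat \<Rightarrow> ennreal" where
  "bd_semigroup b d t g x = (\<integral>\<^sup>+ w. ennreal (case_option 0 g (bd_path b d x t w)) \<partial>bd_noise)"

definition bd_feynman_kac ::
  "(nat \<Rightarrow> real) \<Rightarrow> (nat \<Rightarrow> real) \<Rightarrow> (nat \<Rightarrow> real) \<Rightarrow> real \<Rightarrow> nat \<Rightarrow> ennreal" where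
  "bd_feynman_kac b d V t x =
     (\<integral>\<^sup>+ w. (case bd_path b d x t w of
                None \<Rightarrow> 0
              | Some _ \<Rightarrow> ennreal (exp (- (LINT s:{0..t}|lborel. case_option 0 V (bd_path b d x s w)))))
        \<partial>bd_noise)"

definition birth_u :: "(nat \<Rightarrow> real) \<Rightarrow> (nat \<Rightarrow> real) \<Rightarrow> nat \<Rightarrow> real" where
  "birth_u lam u x = u (x + 1) / u x * lam (x + 1)"

text \<open>At \<open>x = 0\<close> the truncated \<open>x - 1\<close> is harmless, here and below, since \<open>nu 0 = 0\<close>.\<close>

definition death_u :: "(nat \<Rightarrow> real) \<Rightarrow> (nat \<Rightarrow> real) \<Rightarrow> nat \<Rightarrow> real" where
  "death_u nu u x = u (x - 1) / u x * nu x"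

definition potential_u :: "(nat \<Rightarrow> real) \<Rightarrow> (nat \<Rightarrow> real) \<Rightarrow> (nat \<Rightarrow> real) \<Rightarrow> nat \<Rightarrow> real" where
  "potential_u lam nu u x = nu (x + 1) - death_u nu u x + lam x - birth_u lam u x"

definition kappa_u :: "(nat \<Rightarrow> real) \<Rightarrow> (nat \<Rightarrow> real) \<Rightarrow> (nat \<Rightarrow> real) \<Rightarrow> ennreal" where
  "kappa_u lam nu u =
     (\<integral>\<^sup>+ t\<in>{0..}. (SUP x. bd_feynman_kac (birth_u lam u) (death_u nu u) (potential_u lam nu u) t x)
        \<partial>lborel)"

definition fdiff :: "(nat \<Rightarrow> real) \<Rightarrow> nat \<Rightarrow> real" where
  "fdiff f x = f (x + 1) - f x"

definition dirichlet :: "(nat \<Rightarrow> real) \<Rightarrow> nat pmf \<Rightarrow> (nat \<Rightarrow> real) \<Rightarrow> (nat \<Rightarrow> real) \<Rightarrow> real" where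
  "dirichlet lam \<mu> f g = (\<integral>x. lam x * fdiff f x * fdiff g x \<partial>measure_pmf \<mu>)"

text \<open>Finiteness of the energy is integrability of its nonnegative integrand (the Bochner
  integral itself would be \<open>0\<close> when the energy is infinite).\<close>

definition dirichlet_dom :: "(nat \<Rightarrow> real) \<Rightarrow> nat pmf \<Rightarrow> (nat \<Rightarrow> real) set" where
  "dirichlet_dom lam \<mu> =
     {f. integrable (measure_pmf \<mu>) (\<lambda>x. (f x)\<^sup>2) \<and>
         integrable (measure_pmf \<mu>) (\<lambda>x. lam x * fdiff f x * fdiff f x)}"

definition pmf_density :: "nat pmf \<Rightarrow> nat pmf \<Rightarrow> nat \<Rightarrow> real" where
  "pmf_density \<mu> \<pi> x = enn2real (RN_deriv (measure_pmf \<mu>) (measure_pmf \<pi>) x)"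

definition fdv_information :: "(nat \<Rightarrow> real) \<Rightarrow> nat pmf \<Rightarrow> nat pmf \<Rightarrow> ennreal" where
  "fdv_information lam \<pi> \<mu> =
     (let g = (\<lambda>x. sqrt (pmf_density \<mu> \<pi> x))
      in if g \<in> dirichlet_dom lam \<mu> then ennreal (dirichlet lam \<mu> g g) else \<infinity>)"

definition wasserstein :: "('a \<Rightarrow> 'a \<Rightarrow> real) \<Rightarrow> 'a pmf \<Rightarrow> 'a pmf \<Rightarrow> ennreal" where
  "wasserstein dst \<mu>1 \<mu>2 =
     (INF \<gamma>\<in>{\<gamma>. map_pmf fst \<gamma> = \<mu>1 \<and> map_pmf snd \<gamma> = \<mu>2}.
        \<integral>\<^sup>+ (x, y). ennreal (dst x y) \<partial>measure_pmf \<gamma>)"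

definition lyapunov_cond ::
  "(nat \<Rightarrow> real) \<Rightarrow> (nat \<Rightarrow> real) \<Rightarrow> (nat \<Rightarrow> real) \<Rightarrow> real \<Rightarrow> real \<Rightarrow> real \<Rightarrow> real \<Rightarrow> bool" where
  "lyapunov_cond lam nu u \<epsilon> \<theta> a b \<longleftrightarrow> \<epsilon> > 0 \<and> \<theta> > 1 \<and> a \<ge> 0 \<and> b > 0 \<and>
     (\<forall>x. (1 + \<epsilon>) * lam x * (u x)\<^sup>2 + (1 + 1 / \<epsilon>) * nu x * (u (x - 1))\<^sup>2
          \<le> - a * (lam x * (\<theta> - 1) + nu x * (1 / \<theta> - 1)) + b)"

definition dev_term :: "real \<Rightarrow> real \<Rightarrow> real \<Rightarrow> real" where
  "dev_term a b s =
     (if a = 0 then s\<^sup>2 / (2 * b) else (sqrt (b\<^sup>2 + 2 * a * s\<^sup>2) - b) / (2 * a))"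

text \<open>The value at \<open>a = 0\<close> is the limit of the general expression.\<close>

lemma dev_term_limit:
  assumes "b > 0"
  shows "((\<lambda>a. (sqrt (b\<^sup>2 + 2 * a * s\<^sup>2) - b) / (2 * a)) \<longlongrightarrow> dev_term 0 b s) (at_right 0)"
proof -
  have "((\<lambda>a. s\<^sup>2 / (sqrt (b\<^sup>2 + 2 * a * s\<^sup>2) + b)) \<longlongrightarrow> s\<^sup>2 / (sqrt (b\<^sup>2 + 2 * 0 * s\<^sup>2) + b)) (at_right 0)"
    using assms by (intro tendsto_intros) auto
  moreover have "\<forall>\<^sub>F a in at_right 0. s\<^sup>2 / (sqrt (b\<^sup>2 + 2 * a * s\<^sup>2) + b)
      = (sqrt (b\<^sup>2 + 2 * a * s\<^sup>2) - b) / (2 * a)"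
    using eventually_at_right_less[of "0::real"]
  proof eventually_elim
    case (elim a)
    have "(sqrt D - b) * (sqrt D + b) = D - b\<^sup>2" if "0 \<le> D" for D
      using that by (simp add: algebra_simps power2_eq_square)
    from this[of "b\<^sup>2 + 2 * a * s\<^sup>2"]
    have "(sqrt (b\<^sup>2 + 2 * a * s\<^sup>2) - b) * (sqrt (b\<^sup>2 + 2 * a * s\<^sup>2) + b) = 2 * a * s\<^sup>2"
      using elim by simp
    moreover have "sqrt (b\<^sup>2 + 2 * a * s\<^sup>2) + b > 0"
      using assms elim by (intro add_nonneg_pos) auto
    ultimately show ?case
      using elim by (simp add: frac_eq_eq mult.commute)
  qed
  ultimately have "((\<lambda>a. (sqrt (b\<^sup>2 + 2 * a * s\<^sup>2) - b) / (2 * a))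
      \<longlongrightarrow> s\<^sup>2 / (sqrt (b\<^sup>2 + 2 * 0 * s\<^sup>2) + b)) (at_right 0)"
    by (rule Lim_transform_eventually)
  thus ?thesis
    using assms by (simp add: dev_term_def)
qed

text \<open>The supremum is over all admissible constants \<open>\<epsilon>, \<theta>, a, b\<close>. Each term increases to
  infinity with \<open>r\<close>, hence its value at \<open>r = \<infinity>\<close>.\<close>

definition deviation ::
  "(nat \<Rightarrow> real) \<Rightarrow> (nat \<Rightarrow> real) \<Rightarrow> (nat \<Rightarrow> real) \<Rightarrow> ennreal \<Rightarrow> ennreal" where
  "deviation lam nu u r =
     (SUP (\<epsilon>, \<theta>, a, b)\<in>{(\<epsilon>, \<theta>, a, b). lyapunov_cond lam nu u \<epsilon> \<theta> a b}.
        if r = \<infinity> then \<infinity>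
        else ennreal (dev_term a b (enn2real r / enn2real (kappa_u lam nu u))))"

end

theory Submission imports Defs begin

text \<open>
  Let \<open>F\<close> be the distribution function of \<open>\<mu>\<close> and \<open>f\<close> the density of \<open>\<pi>\<close>. On the line the quantile
  coupling transports \<open>\<pi>\<close> to \<open>\<mu>\<close> at cost \<open>\<Sum>x. u x * \<bar>F\<^sub>\<pi> x - F x\<bar>\<close>, since moving mass across the edge
  \<open>{x, x + 1}\<close> costs \<open>u x\<close>. Hoeffding's covariance formula writes \<open>F\<^sub>\<pi> x - F x\<close> as minus the sum over
  \<open>w\<close> of \<open>K x w\<close> times the increment of \<open>f\<close> at \<open>w\<close>, with kernel
  \<open>K x w = F (min x w) * (1 - F (max x w))\<close>. After exchanging the sums, the isoperimetric inequality
  follows from \<open>(\<Sum>z. u z * K x z) \<le> \<kappa>\<^sub>u * \<lambda> x * \<mu> x * u x\<close> for every \<open>x\<close>.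

  The left-hand side is the flux \<open>\<lambda> x * \<mu> x * (g (x + 1) - g x)\<close> of the solution \<open>g\<close> of the Poisson
  equation \<open>- L g = \<rho> - \<mu>(\<rho>)\<close>, where \<open>L\<close> is the generator. Formally the increments of \<open>g\<close> divided by
  \<open>u\<close> are the time integral of the Feynman--Kac semigroup applied to \<open>1\<close>; the inequality that is
  wanted can be read off from the equation for this integral. Let \<open>H x\<close> be the integral over
  \<open>t \<ge> 0\<close> of the Feynman--Kac expectation started at \<open>x\<close>, so \<open>H x \<le> \<kappa>\<^sub>u\<close>. Conditioning on the first jump of the modified process gives
  \<open>(b + d + V) x * H x = 1 + b x * H (x + 1) + d x * H (x - 1)\<close>
  (\<open>fk_potential_first_jump\<close>), where \<open>(b + d + V) x = \<lambda> x + \<nu> (x + 1)\<close> is positive. In terms of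
  \<open>S x = \<lambda> x * \<mu> x * u x * H x\<close> this is a second-order recursion that involves only \<open>\<mu>\<close> and \<open>u\<close>. The
  reflecting boundary at \<open>0\<close> leaves the single free parameter \<open>S 0\<close>, and \<open>S \<ge> 0\<close> at infinity
  bounds that parameter from below; the bound obtained is exactly \<open>S x \<ge> (\<Sum>z. u z * K x z)\<close>
  (\<open>green_sum_le_flux\<close>).

  For the transport-information inequality put \<open>g = sqrt f\<close>, so that the increment of \<open>f\<close> is that of
  \<open>g\<close> times \<open>g x + g (x + 1)\<close>. Cauchy--Schwarz bounds the isoperimetric right-hand side by the square
  root of the information \<open>I\<close> times \<open>\<Sum>x. \<lambda> x * \<mu> x * (u x)\<^sup>2 * (g x + g (x + 1))\<^sup>2\<close>. Young's inequality
  with parameter \<open>\<epsilon>\<close> and the Lyapunov condition, tested with the function \<open>\<theta> ^ x\<close>, bound the second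
  factor by \<open>b + a * I\<close> (\<open>lyapunov_energy_bound\<close>). Hence the distance divided by \<open>\<kappa>\<^sub>u\<close> is at most the
  square root of \<open>I * (b + a * I)\<close>, which is solved for \<open>I\<close>.
\<close>

section \<open>Quantile coupling on the natural numbers\<close>

definition pmf_cdf :: "nat pmf \<Rightarrow> nat \<Rightarrow> real" where
  "pmf_cdf p x = (\<Sum>y\<le>x. pmf p y)"

lemma pmf_cdf_eq_measure: "pmf_cdf p x = measure (measure_pmf p) {..x}"
  unfolding pmf_cdf_def by (rule measure_measure_pmf_finite[symmetric]) simp

lemma pmf_cdf_nonneg: "0 \<le> pmf_cdf p x" and pmf_cdf_le_1: "pmf_cdf p x \<le> 1"
  unfolding pmf_cdf_eq_measure by auto

lemma pmf_cdf_mono: "x \<le> y \<Longrightarrow> pmf_cdf p x \<le> pmf_cdf p y"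
  unfolding pmf_cdf_eq_measure by (intro measure_pmf.finite_measure_mono) auto

lemma pmf_cdf_tendsto_1: "pmf_cdf p \<longlonglongrightarrow> 1"
proof -
  have "(\<lambda>n. measure (measure_pmf p) {..n}) \<longlonglongrightarrow> measure (measure_pmf p) (\<Union>n. {..n})"
    by (rule measure_pmf.finite_Lim_measure_incseq) (auto simp: incseq_def)
  moreover have "(\<Union>n::nat. {..n}) = UNIV" by auto
  ultimately show ?thesis by (simp add: pmf_cdf_eq_measure[abs_def])
qed

lemma pmf_eq_pmf_cdf_diff: "pmf p x = pmf_cdf p x - (if x = 0 then 0 else pmf_cdf p (x - 1))"
  by (cases x) (auto simp: pmf_cdf_def)

lemma pmf_eqI_pmf_cdf:
  assumes "\<And>x. pmf_cdf p x = pmf_cdf q x" shows "p = q"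
  by (rule pmf_eqI) (simp add: pmf_eq_pmf_cdf_diff assms)

definition quantile :: "nat pmf \<Rightarrow> real \<Rightarrow> nat" where
  "quantile p t = (LEAST n. t \<le> pmf_cdf p n)"

lemma quantile_le_iff:
  assumes "t < 1" shows "quantile p t \<le> x \<longleftrightarrow> t \<le> pmf_cdf p x"
proof -
  have "\<exists>n. t \<le> pmf_cdf p n"
    using order_tendstoD(1)[OF pmf_cdf_tendsto_1 assms, of p]
    by (auto simp: eventually_sequentially intro: less_imp_le)
  hence "t \<le> pmf_cdf p (quantile p t)" unfolding quantile_def by (rule LeastI_ex)
  thus ?thesis using pmf_cdf_mono[of "quantile p t" x p] unfolding quantile_def
    by (auto intro: Least_le)
qed

lemma measurable_quantile [measurable]: "quantile p \<in> borel \<rightarrow>\<^sub>M count_space UNIV"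
  unfolding quantile_def by measurable

text \<open>The end point \<open>1\<close> is left out because there the set of which a quantile is the least element
  may be empty.\<close>
definition unit_interval :: "real measure" where
  "unit_interval = restrict_space lborel {0<..<1}"

lemma prob_space_unit_interval: "prob_space unit_interval"
  by (rule prob_spaceI) (simp add: unit_interval_def space_restrict_space emeasure_restrict_space)

lemma measurable_unit_interval:
  "f \<in> borel \<rightarrow>\<^sub>M M \<Longrightarrow> f \<in> unit_interval \<rightarrow>\<^sub>M M"
  unfolding unit_interval_def by (intro measurable_restrict_space1) simp

lemma space_unit_interval: "space unit_interval = {0<..<1}"
  by (simp add: unit_interval_def space_restrict_space)

lemma emeasure_unit_interval:
  "A \<in> sets borel \<Longrightarrow> A \<subseteq> {0<..<1} \<Longrightarrow> emeasure unit_interval A = emeasure lborel A"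
  unfolding unit_interval_def by (intro emeasure_restrict_space) auto

definition quantile_coupling :: "nat pmf \<Rightarrow> nat pmf \<Rightarrow> (nat \<times> nat) pmf" where
  "quantile_coupling p q =
     Abs_pmf (distr unit_interval (count_space UNIV) (\<lambda>t. (quantile p t, quantile q t)))"

lemma measurable_quantile_pair:
  "(\<lambda>t. (quantile p t, quantile q t)) \<in> unit_interval \<rightarrow>\<^sub>M count_space UNIV"
proof -
  have "(\<lambda>t. (quantile p t, quantile q t)) \<in> borel \<rightarrow>\<^sub>M count_space UNIV \<Otimes>\<^sub>M count_space UNIV"
    by (intro measurable_Pair measurable_quantile)
  thus ?thesis
    by (intro measurable_unit_interval) (simp add: pair_measure_countable)
qed

lemma measure_pmf_quantile_coupling:
  "measure_pmf (quantile_coupling p q)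
     = distr unit_interval (count_space UNIV) (\<lambda>t. (quantile p t, quantile q t))"
proof -
  interpret prob_space unit_interval by (rule prob_space_unit_interval)
  let ?D = "distr unit_interval (count_space UNIV) (\<lambda>t. (quantile p t, quantile q t))"
  interpret D: prob_space ?D by (rule prob_space_distr) (rule measurable_quantile_pair)
  have "AE x in ?D. measure ?D {x} \<noteq> 0"
    by (subst D.AE_support_countable) auto
  thus ?thesis unfolding quantile_coupling_def
    by (intro Abs_pmf_inverse) (auto intro: D.prob_space_axioms)
qed

lemma quantile_coupling_marginals:
  "map_pmf fst (quantile_coupling p q) = p" "map_pmf snd (quantile_coupling p q) = q"
proof -
  have iv: "measure unit_interval {t \<in> {0<..<1}. t \<le> pmf_cdf r x} = pmf_cdf r x" for r x
  proof -
    have "emeasure lborel {t \<in> {0<..<1}. t \<le> pmf_cdf r x} = emeasure lborel {0<..pmf_cdf r x}"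
    proof (rule emeasure_eq_AE)
      have "AE t in lborel. t \<noteq> (1::real)" by (rule AE_lborel_singleton)
      thus "AE t in lborel. t \<in> {t \<in> {0<..<1}. t \<le> pmf_cdf r x} \<longleftrightarrow> t \<in> {0<..pmf_cdf r x}"
        by eventually_elim (use pmf_cdf_le_1[of r x] in auto)
    qed auto
    thus ?thesis
      unfolding measure_def by (subst emeasure_unit_interval) (auto simp: pmf_cdf_nonneg)
  qed
  have marginal: "map_pmf h (quantile_coupling p q) = r"
    if h: "\<And>t. h (quantile p t, quantile q t) = quantile r t" for h r
  proof (rule pmf_eqI_pmf_cdf)
    fix x
    have "pmf_cdf (map_pmf h (quantile_coupling p q)) x
       = measure (measure_pmf (quantile_coupling p q)) (h -` {..x})"
      by (simp add: pmf_cdf_eq_measure measure_map_pmf)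
    also have "\<dots> = measure unit_interval {t \<in> {0<..<1}. t \<le> pmf_cdf r x}"
      unfolding measure_pmf_quantile_coupling
      by (subst measure_distr[OF measurable_quantile_pair])
         (auto simp: space_unit_interval quantile_le_iff h intro!: arg_cong2[where f = measure])
    finally show "pmf_cdf (map_pmf h (quantile_coupling p q)) x = pmf_cdf r x" by (simp only: iv)
  qed
  show "map_pmf fst (quantile_coupling p q) = p" by (rule marginal) simp
  show "map_pmf snd (quantile_coupling p q) = q" by (rule marginal) simp
qed

lemma ennreal_increment_sum:
  fixes \<rho> :: "nat \<Rightarrow> real"
  assumes "mono \<rho>"
  shows "ennreal \<bar>\<rho> m - \<rho> n\<bar>
    = (\<Sum>x. ennreal (\<rho> (x + 1) - \<rho> x) * indicator {x. min m n \<le> x \<and> x < max m n} x)"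
proof -
  have inc: "0 \<le> \<rho> (x + 1) - \<rho> x" for x using monoD[OF assms, of x "x + 1"] by simp
  have "(\<Sum>x. ennreal (\<rho> (x + 1) - \<rho> x) * indicator {x. min m n \<le> x \<and> x < max m n} x)
     = (\<Sum>x\<in>{min m n..<max m n}. ennreal (\<rho> (x + 1) - \<rho> x) * indicator {x. min m n \<le> x \<and> x < max m n} x)"
    by (rule suminf_finite) auto
  also have "\<dots> = (\<Sum>x\<in>{min m n..<max m n}. ennreal (\<rho> (x + 1) - \<rho> x))"
    by (intro sum.cong) auto
  also have "\<dots> = ennreal (\<Sum>x\<in>{min m n..<max m n}. \<rho> (Suc x) - \<rho> x)"
    using inc by (subst sum_ennreal) auto
  also have "(\<Sum>x\<in>{min m n..<max m n}. \<rho> (Suc x) - \<rho> x) = \<rho> (max m n) - \<rho> (min m n)"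
    by (rule sum_Suc_diff') simp
  also have "\<dots> = \<bar>\<rho> m - \<rho> n\<bar>"
    using monoD[OF assms, of m n] monoD[OF assms, of n m] by (auto simp: min_def max_def)
  finally show ?thesis ..
qed

text \<open>The two quantiles lie on different sides of the edge \<open>{x, x + 1}\<close> exactly when the
  uniform variable falls between the two values of the distribution functions at \<open>x\<close>.\<close>
lemma wasserstein_le_cdf_sum:
  fixes \<rho> :: "nat \<Rightarrow> real"
  assumes "mono \<rho>"
  shows "wasserstein (\<lambda>x y. \<bar>\<rho> x - \<rho> y\<bar>) p q
    \<le> (\<Sum>x. ennreal (\<rho> (x + 1) - \<rho> x) * ennreal \<bar>pmf_cdf p x - pmf_cdf q x\<bar>)"
proof -
  let ?Q = "\<lambda>t. (quantile p t, quantile q t)"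
  let ?B = "\<lambda>x. {t \<in> {0<..<1}. min (pmf_cdf p x) (pmf_cdf q x) < t \<and> t \<le> max (pmf_cdf p x) (pmf_cdf q x)}"
  have "wasserstein (\<lambda>x y. \<bar>\<rho> x - \<rho> y\<bar>) p q
     \<le> (\<integral>\<^sup>+ (x, y). ennreal \<bar>\<rho> x - \<rho> y\<bar> \<partial>measure_pmf (quantile_coupling p q))"
    unfolding wasserstein_def by (rule INF_lower) (simp add: quantile_coupling_marginals)
  also have "\<dots> = (\<integral>\<^sup>+ t. ennreal \<bar>\<rho> (quantile p t) - \<rho> (quantile q t)\<bar> \<partial>unit_interval)"
    unfolding measure_pmf_quantile_coupling
    by (subst nn_integral_distr[OF measurable_quantile_pair]) auto
  also have "\<dots> = (\<integral>\<^sup>+ t. (\<Sum>x. ennreal (\<rho> (x + 1) - \<rho> x) * indicator (?B x) t) \<partial>unit_interval)"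
  proof (rule nn_integral_cong)
    fix t assume "t \<in> space unit_interval"
    hence t: "0 < t" "t < 1" by (auto simp: space_unit_interval)
    have "min (quantile p t) (quantile q t) \<le> x \<and> x < max (quantile p t) (quantile q t)
        \<longleftrightarrow> t \<in> ?B x" for x
      using t quantile_le_iff[of t p x] quantile_le_iff[of t q x] by (auto simp: min_def max_def)
    thus "ennreal \<bar>\<rho> (quantile p t) - \<rho> (quantile q t)\<bar>
       = (\<Sum>x. ennreal (\<rho> (x + 1) - \<rho> x) * indicator (?B x) t)"
      by (simp add: ennreal_increment_sum[OF assms] indicator_def)
  qed
  also have "\<dots> = (\<Sum>x. \<integral>\<^sup>+ t. ennreal (\<rho> (x + 1) - \<rho> x) * indicator (?B x) t \<partial>unit_interval)"
    by (intro nn_integral_suminf measurable_unit_interval) measurable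
  also have "\<dots> \<le> (\<Sum>x. ennreal (\<rho> (x + 1) - \<rho> x) * ennreal \<bar>pmf_cdf p x - pmf_cdf q x\<bar>)"
  proof (intro suminf_le allI)
    fix x
    have B: "?B x \<in> sets borel" by measurable
    have "?B x \<in> sets unit_interval"
      unfolding unit_interval_def by (subst sets_restrict_space_iff) (use B in auto)
    hence "(\<integral>\<^sup>+ t. ennreal (\<rho> (x + 1) - \<rho> x) * indicator (?B x) t \<partial>unit_interval)
       = ennreal (\<rho> (x + 1) - \<rho> x) * emeasure unit_interval (?B x)"
      by (rule nn_integral_cmult_indicator)
    also have "emeasure unit_interval (?B x) = emeasure lborel (?B x)"
      using B by (intro emeasure_unit_interval) auto
    also have "\<dots> \<le> emeasure lborel {min (pmf_cdf p x) (pmf_cdf q x)<..max (pmf_cdf p x) (pmf_cdf q x)}"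
      by (rule emeasure_mono) auto
    also have "\<dots> = ennreal \<bar>pmf_cdf p x - pmf_cdf q x\<bar>"
      by (subst emeasure_lborel_Ioc) (auto simp: min_def max_def)
    finally show "(\<integral>\<^sup>+ t. ennreal (\<rho> (x + 1) - \<rho> x) * indicator (?B x) t \<partial>unit_interval)
      \<le> ennreal (\<rho> (x + 1) - \<rho> x) * ennreal \<bar>pmf_cdf p x - pmf_cdf q x\<bar>"
      by (simp add: mult_left_mono)
  qed auto
  finally show ?thesis .
qed

section \<open>Increments of a density and transport cost\<close>

text \<open>Hoeffding's covariance formula with absolute values: \<open>F\<^sub>\<pi> x - F x\<close> is the double
  integral of \<open>f y - f z\<close> against \<open>\<mu>\<close> over \<open>y \<le> x < z\<close>; telescoping \<open>f\<close> between \<open>y\<close> and \<open>z\<close> charges the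
  increment at \<open>w\<close> with the mass of \<open>{y \<le> min x w} \<times> {z > max x w}\<close>. The sum may be infinite, hence the values in \<open>[0,\<infinity>]\<close>.\<close>
lemma cdf_difference_le_increments:
  fixes f :: "nat \<Rightarrow> real"
  assumes dens: "measure_pmf \<pi> = density (measure_pmf \<mu>) (\<lambda>x. ennreal (f x))"
    and f: "\<And>x. 0 \<le> f x"
  shows "ennreal \<bar>pmf_cdf \<pi> x - pmf_cdf \<mu> x\<bar>
    \<le> (\<Sum>w. ennreal \<bar>fdiff f w\<bar> *
          ennreal (pmf_cdf \<mu> (min x w) * (1 - pmf_cdf \<mu> (max x w))))"
proof -
  define P where "P = pmf_cdf \<pi> x"
  define F where "F = pmf_cdf \<mu> x"
  have "integrable (measure_pmf \<pi>) (\<lambda>_. 1 :: real)" by simp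
  hence intf: "integrable (measure_pmf \<mu>) f"
    unfolding dens using f by (simp add: integrable_density)
  have meas: "measure (measure_pmf \<pi>) A = (\<integral>z. f z * indicator A z \<partial>measure_pmf \<mu>)" for A
  proof -
    have "measure (measure_pmf \<pi>) A = (\<integral>z. indicator A z \<partial>measure_pmf \<pi>)" by simp
    also have "\<dots> = (\<integral>z. f z * indicator A z \<partial>measure_pmf \<mu>)"
      unfolding dens using f by (subst integral_density) auto
    finally show ?thesis .
  qed
  have intA: "integrable (measure_pmf \<mu>) (\<lambda>z. f z * indicator A z)" for A
    using integrable_real_mult_indicator[OF _ intf, of A] by simp
  have compl: "measure (measure_pmf p) {x<..} = 1 - pmf_cdf p x" for p :: "nat pmf" and x
  proof -
    have "{x<..} = space (measure_pmf p) - {..x}" by auto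
    thus ?thesis unfolding pmf_cdf_eq_measure
      by (simp only: measure_pmf.prob_compl[of "{..x}" p] sets_measure_pmf UNIV_I)
  qed
  have ind: "integrable (measure_pmf \<mu>) (indicat_real A)" for A
    by (rule measure_pmf.integrable_const_bound[where B = 1]) auto
  \<comment> \<open>\<open>h z\<close> is the integral over \<open>y\<close> of \<open>f y - f z\<close> on \<open>y \<le> x < z\<close>.\<close>
  define h where "h z = indicator {x<..} z * (P - F * f z)" for z
  have h_alt: "h = (\<lambda>z. P * indicator {x<..} z - F * (f z * indicator {x<..} z))"
    by (auto simp: h_def fun_eq_iff indicator_def)
  have h_int: "integrable (measure_pmf \<mu>) h"
    unfolding h_alt using intA ind by (intro Bochner_Integration.integrable_diff) auto
  have "(\<integral>z. h z \<partial>measure_pmf \<mu>) = P * (1 - F) - F * (1 - P)"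
    unfolding h_alt using intA ind
    by (subst Bochner_Integration.integral_diff) (auto simp: meas[symmetric] compl P_def F_def)
  also have "\<dots> = P - F" by (simp add: algebra_simps)
  finally have "ennreal \<bar>P - F\<bar> \<le> (\<integral>\<^sup>+ z. ennreal \<bar>h z\<bar> \<partial>measure_pmf \<mu>)"
    using integral_norm_bound_ennreal[OF h_int] by simp
  also have "\<dots> \<le> (\<integral>\<^sup>+ z. \<integral>\<^sup>+ y. (\<Sum>w. ennreal \<bar>fdiff f w\<bar> *
      (indicator {..min x w} y * indicator {max x w<..} z)) \<partial>measure_pmf \<mu> \<partial>measure_pmf \<mu>)"
  proof (rule nn_integral_mono)
    fix z
    show "ennreal \<bar>h z\<bar> \<le> (\<integral>\<^sup>+ y. (\<Sum>w. ennreal \<bar>fdiff f w\<bar> *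
      (indicator {..min x w} y * indicator {max x w<..} z)) \<partial>measure_pmf \<mu>)"
    proof (cases "x < z")
      case True
      let ?g = "\<lambda>y. f y * indicator {..x} y - f z * indicator {..x} y"
      have g_int: "integrable (measure_pmf \<mu>) ?g"
        using intA ind by (intro Bochner_Integration.integrable_diff) auto
      have "h z = (\<integral>y. ?g y \<partial>measure_pmf \<mu>)"
        using True intA ind
        by (subst Bochner_Integration.integral_diff)
           (auto simp: h_def P_def pmf_cdf_eq_measure meas F_def)
      hence "ennreal \<bar>h z\<bar> \<le> (\<integral>\<^sup>+ y. ennreal \<bar>?g y\<bar> \<partial>measure_pmf \<mu>)"
        using integral_norm_bound_ennreal[OF g_int] by simp
      also have "\<dots> \<le> (\<integral>\<^sup>+ y. (\<Sum>w. ennreal \<bar>fdiff f w\<bar> *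
        (indicator {..min x w} y * indicator {max x w<..} z)) \<partial>measure_pmf \<mu>)"
      proof (rule nn_integral_mono)
        fix y
        show "ennreal \<bar>?g y\<bar> \<le> (\<Sum>w. ennreal \<bar>fdiff f w\<bar> *
          (indicator {..min x w} y * indicator {max x w<..} z))"
        proof (cases "y \<le> x")
          case yx: True
          have "f z - f y = (\<Sum>w\<in>{y..<z}. fdiff f w)"
            using sum_Suc_diff'[of y z f] True yx by (simp add: fdiff_def)
          hence "\<bar>?g y\<bar> \<le> (\<Sum>w\<in>{y..<z}. \<bar>fdiff f w\<bar>)"
            using sum_abs[of "fdiff f" "{y..<z}"] yx by (simp add: abs_minus_commute[of "f y"])
          hence "ennreal \<bar>?g y\<bar> \<le> (\<Sum>w\<in>{y..<z}. ennreal \<bar>fdiff f w\<bar>)"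
            by (subst sum_ennreal) (auto simp: ennreal_leI)
          also have "\<dots> = (\<Sum>w\<in>{y..<z}. ennreal \<bar>fdiff f w\<bar> *
              (indicator {..min x w} y * indicator {max x w<..} z))"
            using True yx by (intro sum.cong) auto
          also have "\<dots> \<le> (\<Sum>w. ennreal \<bar>fdiff f w\<bar> *
              (indicator {..min x w} y * indicator {max x w<..} z))"
            by (rule sum_le_suminf) auto
          finally show ?thesis .
        qed simp
      qed
      finally show ?thesis .
    qed (simp add: h_def)
  qed
  also have "\<dots> = (\<Sum>w. ennreal \<bar>fdiff f w\<bar> *
          ennreal (pmf_cdf \<mu> (min x w) * (1 - pmf_cdf \<mu> (max x w))))"
    by (simp add: nn_integral_suminf nn_integral_cmult nn_integral_multc
        measure_pmf.emeasure_eq_measure compl pmf_cdf_eq_measure[symmetric]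
        ennreal_mult pmf_cdf_nonneg pmf_cdf_le_1)
  finally show ?thesis unfolding P_def F_def .
qed

lemma suminf_swap_ennreal:
  fixes a :: "nat \<Rightarrow> nat \<Rightarrow> ennreal"
  shows "(\<Sum>x. \<Sum>w. a x w) = (\<Sum>w. \<Sum>x. a x w)"
proof -
  have "(\<Sum>x. \<Sum>w. a x w) = (\<integral>\<^sup>+ x. (\<Sum>w. a x w) \<partial>count_space UNIV)"
    by (simp only: nn_integral_count_space_nat)
  also have "\<dots> = (\<Sum>w. \<integral>\<^sup>+ x. a x w \<partial>count_space UNIV)"
    by (rule nn_integral_suminf) simp
  finally show ?thesis by (simp only: nn_integral_count_space_nat)
qed

text \<open>The kernel is symmetric, so the bound on its \<open>u\<close>-weighted row sums applies after the
  sums are exchanged.\<close>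
lemma wasserstein_le_weighted_increments:
  fixes \<rho> f \<sigma> :: "nat \<Rightarrow> real"
  defines "u \<equiv> \<lambda>x. \<rho> (x + 1) - \<rho> x"
  assumes "mono \<rho>"
    and dens: "measure_pmf \<pi> = density (measure_pmf \<mu>) (\<lambda>x. ennreal (f x))"
    and f: "\<And>x. 0 \<le> f x"
    and green: "\<And>x. (\<Sum>z. ennreal (u z * (pmf_cdf \<mu> (min x z) * (1 - pmf_cdf \<mu> (max x z)))))
       \<le> \<sigma> x"
  shows "wasserstein (\<lambda>x y. \<bar>\<rho> x - \<rho> y\<bar>) \<pi> \<mu> \<le> (\<Sum>w. ennreal \<bar>fdiff f w\<bar> * ennreal (\<sigma> w))"
proof -
  have u: "0 \<le> u x" for x using monoD[OF \<open>mono \<rho>\<close>, of x "x + 1"] by (simp add: u_def)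
  let ?K = "\<lambda>x z. pmf_cdf \<mu> (min x z) * (1 - pmf_cdf \<mu> (max x z))"
  have "wasserstein (\<lambda>x y. \<bar>\<rho> x - \<rho> y\<bar>) \<pi> \<mu> \<le> (\<Sum>x. ennreal (u x) * ennreal \<bar>pmf_cdf \<pi> x - pmf_cdf \<mu> x\<bar>)"
    unfolding u_def by (rule wasserstein_le_cdf_sum) fact
  also have "\<dots> \<le> (\<Sum>x. ennreal (u x) * (\<Sum>w. ennreal \<bar>fdiff f w\<bar> * ennreal (?K x w)))"
    by (intro suminf_le mult_left_mono allI cdf_difference_le_increments[OF dens f]) auto
  also have "\<dots> = (\<Sum>x. \<Sum>w. ennreal \<bar>fdiff f w\<bar> * ennreal (u x * ?K x w))"
  proof (intro suminf_cong)
    fix x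
    have "ennreal (u x) * (ennreal \<bar>fdiff f w\<bar> * ennreal (?K x w))
        = ennreal \<bar>fdiff f w\<bar> * ennreal (u x * ?K x w)" for w
    proof -
      have "0 \<le> ?K x w" by (simp add: pmf_cdf_nonneg pmf_cdf_le_1)
      show ?thesis unfolding ennreal_mult[OF u \<open>0 \<le> ?K x w\<close>] by (rule mult.left_commute)
    qed
    thus "ennreal (u x) * (\<Sum>w. ennreal \<bar>fdiff f w\<bar> * ennreal (?K x w))
        = (\<Sum>w. ennreal \<bar>fdiff f w\<bar> * ennreal (u x * ?K x w))"
      by (simp only: ennreal_suminf_cmult[symmetric])
  qed
  also have "\<dots> = (\<Sum>w. \<Sum>x. ennreal \<bar>fdiff f w\<bar> * ennreal (u x * ?K x w))"
    by (rule suminf_swap_ennreal)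
  also have "\<dots> = (\<Sum>w. ennreal \<bar>fdiff f w\<bar> * (\<Sum>x. ennreal (u x * ?K w x)))"
    by (simp only: ennreal_suminf_cmult min.commute max.commute)
  also have "\<dots> \<le> (\<Sum>w. ennreal \<bar>fdiff f w\<bar> * ennreal (\<sigma> w))"
    by (intro suminf_le mult_left_mono green allI) auto
  finally show ?thesis .
qed

section \<open>First-jump equation for the Feynman--Kac functional\<close>

definition clock_coin :: "(real \<times> real) measure" where
  "clock_coin = density lborel (\<lambda>x. ennreal (exponential_density 1 x))
     \<Otimes>\<^sub>M uniform_measure lborel {0..1}"

lemma prob_space_clock_coin: "prob_space clock_coin"
  unfolding clock_coin_def
  by (intro prob_space_pair prob_space_exponential_density prob_space_uniform_measure) auto

lemma bd_noise_eq: "bd_noise = (\<Pi>\<^sub>M n\<in>(UNIV::nat set). clock_coin)"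
  unfolding bd_noise_def clock_coin_def ..

lemma sets_clock_coin [measurable_cong]: "sets clock_coin = sets (borel \<Otimes>\<^sub>M borel)"
  unfolding clock_coin_def by (intro sets_pair_measure_cong) auto

lemma sets_bd_noise [measurable_cong]: "sets bd_noise = sets (\<Pi>\<^sub>M n\<in>(UNIV::nat set). clock_coin)"
  unfolding bd_noise_eq ..

lemma space_clock_coin [simp]: "space clock_coin = UNIV"
  unfolding clock_coin_def by (simp add: space_pair_measure)

lemma space_bd_noise [simp]: "space bd_noise = UNIV"
  unfolding bd_noise_eq by (auto simp: space_PiM)

lemma sequence_space_clock_coin: "sequence_space clock_coin"
proof -
  interpret prob_space clock_coin by (rule prob_space_clock_coin)
  show ?thesis by unfold_locales
qed

lemma nn_integral_bd_noise_shift: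
  assumes [measurable]: "f \<in> borel_measurable bd_noise"
  shows "(\<integral>\<^sup>+ w. f w \<partial>bd_noise) = (\<integral>\<^sup>+ s. \<integral>\<^sup>+ w. f (case_nat s w) \<partial>bd_noise \<partial>clock_coin)"
proof -
  interpret sequence_space clock_coin by (rule sequence_space_clock_coin)
  interpret N: prob_space bd_noise by (rule prob_space_bd_noise)
  have [measurable]: "(\<lambda>(s, w). case_nat s w) \<in> clock_coin \<Otimes>\<^sub>M S \<rightarrow>\<^sub>M S"
    by measurable
  have f: "f \<in> borel_measurable S" using assms unfolding bd_noise_eq .
  have "(\<integral>\<^sup>+ w. f w \<partial>bd_noise)
      = (\<integral>\<^sup>+ w. f w \<partial>distr (clock_coin \<Otimes>\<^sub>M S) S (\<lambda>(s, w). case_nat s w))"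
    unfolding bd_noise_eq PiM_iter ..
  also have "\<dots> = (\<integral>\<^sup>+ p. f (case p of (s, w) \<Rightarrow> case_nat s w) \<partial>(clock_coin \<Otimes>\<^sub>M S))"
    using f by (intro nn_integral_distr) auto
  also have "\<dots> = (\<integral>\<^sup>+ s. \<integral>\<^sup>+ w. f (case_nat s w) \<partial>S \<partial>clock_coin)"
    using f by (subst P.nn_integral_fst[symmetric]) (auto simp: bd_noise_eq)
  finally show ?thesis unfolding bd_noise_eq .
qed

lemma measurable_bd_jump_chain [measurable]:
  "(\<lambda>w. bd_jump_chain b d x w n) \<in> bd_noise \<rightarrow>\<^sub>M count_space UNIV"
proof (induction n)
  case (Suc n)
  note [measurable] = Suc
  have "(\<lambda>w. if snd (w n) * (b y + d y) < b y then y + 1 else y - 1)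
      \<in> bd_noise \<rightarrow>\<^sub>M count_space UNIV" for y
    by measurable
  from measurable_compose_countable[OF this Suc] show ?case
    by (simp add: Let_def)
qed simp

lemma measurable_bd_jump_time [measurable]:
  "(\<lambda>w. bd_jump_time b d x w n) \<in> borel_measurable bd_noise"
proof -
  have "(\<lambda>w. fst (w k) / (b y + d y)) \<in> borel_measurable bd_noise" for k y
    by measurable
  note [measurable] = measurable_compose_countable[OF this measurable_bd_jump_chain]
  show ?thesis unfolding bd_jump_time_def Let_def by measurable
qed

lemma measurable_bd_path [measurable]:
  "(\<lambda>p. bd_path b d x (fst p) (snd p)) \<in> borel \<Otimes>\<^sub>M bd_noise \<rightarrow>\<^sub>M count_space UNIV"
proof -
  have L: "(\<lambda>p. LEAST n. fst p < bd_jump_time b d x (snd p) (Suc n))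
      \<in> borel \<Otimes>\<^sub>M bd_noise \<rightarrow>\<^sub>M count_space UNIV"
    by measurable
  have "(\<lambda>p. Some (bd_jump_chain b d x (snd p) n))
      \<in> (borel :: real measure) \<Otimes>\<^sub>M bd_noise \<rightarrow>\<^sub>M count_space UNIV" for n
    by measurable
  note [measurable] = measurable_compose_countable[OF this L]
  show ?thesis unfolding bd_path_def by measurable
qed

text \<open>The integrand of \<open>bd_feynman_kac\<close>, whose joint measurability in time and noise is what
  Tonelli's theorem asks for.\<close>
definition fk_weight ::
  "(nat \<Rightarrow> real) \<Rightarrow> (nat \<Rightarrow> real) \<Rightarrow> (nat \<Rightarrow> real) \<Rightarrow> nat \<Rightarrow> real \<Rightarrow> (nat \<Rightarrow> real \<times> real) \<Rightarrow> ennreal" where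
  "fk_weight b d V x t w = (case bd_path b d x t w of
      None \<Rightarrow> 0
    | Some _ \<Rightarrow> ennreal (exp (- (LINT s:{0..t}|lborel. case_option 0 V (bd_path b d x s w)))))"

lemma measurable_fk_weight [measurable]:
  "(\<lambda>p. fk_weight b d V x (fst p) (snd p)) \<in> borel_measurable (borel \<Otimes>\<^sub>M bd_noise)"
proof -
  have "(\<lambda>q. bd_path b d x (fst (snd q, snd (fst q))) (snd (snd q, snd (fst q)))) \<in>
     (borel \<Otimes>\<^sub>M bd_noise) \<Otimes>\<^sub>M lborel \<rightarrow>\<^sub>M count_space UNIV"
    by (rule measurable_compose[OF _ measurable_bd_path]) measurable
  hence p: "(\<lambda>q. bd_path b d x (snd q) (snd (fst q))) \<in>
     ((borel :: real measure) \<Otimes>\<^sub>M bd_noise) \<Otimes>\<^sub>M lborel \<rightarrow>\<^sub>M count_space UNIV"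
    by simp
  have V: "(\<lambda>q. case_option 0 V (bd_path b d x (snd q) (snd (fst q)))) \<in>
     borel_measurable (((borel :: real measure) \<Otimes>\<^sub>M bd_noise) \<Otimes>\<^sub>M lborel)"
    by (rule measurable_compose[OF p]) simp
  have I: "(\<lambda>q. indicator {0..fst (fst q)} (snd q) :: real)
      \<in> borel_measurable (((borel :: real measure) \<Otimes>\<^sub>M bd_noise) \<Otimes>\<^sub>M lborel)"
    unfolding indicator_def atLeastAtMost_iff by measurable
  have "(\<lambda>q. indicator {0..fst (fst q)} (snd q) *\<^sub>R case_option 0 V (bd_path b d x (snd q) (snd (fst q))))
      \<in> borel_measurable (((borel :: real measure) \<Otimes>\<^sub>M bd_noise) \<Otimes>\<^sub>M lborel)"
    by (rule borel_measurable_scaleR[OF I V])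
  hence [measurable]: "(\<lambda>p. LINT s:{0..fst p}|lborel. case_option 0 V (bd_path b d x s (snd p)))
      \<in> borel_measurable ((borel :: real measure) \<Otimes>\<^sub>M bd_noise)"
    unfolding set_lebesgue_integral_def
    by (intro lborel.borel_measurable_lebesgue_integral) (simp add: split_beta')
  have "fk_weight b d V x (fst p) (snd p) = (if bd_path b d x (fst p) (snd p) = None then 0
     else ennreal (exp (- (LINT s:{0..fst p}|lborel. case_option 0 V (bd_path b d x s (snd p))))))" for p
    by (auto simp: fk_weight_def split: option.split)
  thus ?thesis by simp
qed

lemma bd_jump_chain_case_nat:
  "bd_jump_chain b d x (case_nat s w) (Suc n) =
     bd_jump_chain b d (if snd s * (b x + d x) < b x then x + 1 else x - 1) w n"
  by (induction n) (auto simp: Let_def)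

lemma bd_jump_time_case_nat:
  "bd_jump_time b d x (case_nat s w) (Suc n) = fst s / (b x + d x) +
     bd_jump_time b d (if snd s * (b x + d x) < b x then x + 1 else x - 1) w n"
  unfolding bd_jump_time_def sum.lessThan_Suc_shift Let_def
  by (simp only: bd_jump_chain_case_nat bd_jump_chain.simps(1) nat.case)

text \<open>Strong Markov property at the first jump, in pathwise form: the first clock and coin fix the
  first holding time and jump, the shifted noise drives the process from there on.\<close>
lemma bd_path_case_nat:
  "bd_path b d x t (case_nat s w) = (if t < fst s / (b x + d x) then Some x
     else bd_path b d (if snd s * (b x + d x) < b x then x + 1 else x - 1)
            (t - fst s / (b x + d x)) w)"
proof -
  define T where "T = fst s / (b x + d x)"
  define y where "y = (if snd s * (b x + d x) < b x then x + 1 else x - 1)"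
  let ?P = "\<lambda>n. t < bd_jump_time b d x (case_nat s w) (Suc n)"
  have J0: "?P 0 \<longleftrightarrow> t < T"
    by (simp only: bd_jump_time_case_nat T_def) (simp add: bd_jump_time_def)
  have JS: "?P (Suc n) \<longleftrightarrow> t - T < bd_jump_time b d y w (Suc n)" for n
    by (simp only: bd_jump_time_case_nat T_def y_def) linarith
  have "bd_path b d x t (case_nat s w) = (if t < T then Some x else bd_path b d y (t - T) w)"
  proof (cases "t < T")
    case True
    hence "?P 0" using J0 by blast
    hence "(LEAST n. ?P n) = 0" by (rule Least_eq_0)
    with \<open>?P 0\<close> True show ?thesis unfolding bd_path_def by auto
  next
    case False
    hence n0: "\<not> ?P 0" using J0 by blast
    show ?thesis
    proof (cases "\<exists>n. ?P (Suc n)")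
      case True
      then obtain n where n: "?P (Suc n)" by blast
      have "(LEAST n. ?P n) = Suc (LEAST n. ?P (Suc n))"
        by (rule Least_Suc[OF n n0])
      also have "\<dots> = Suc (LEAST n. t - T < bd_jump_time b d y w (Suc n))"
        unfolding JS ..
      finally have L: "(LEAST n. ?P n) = Suc (LEAST n. t - T < bd_jump_time b d y w (Suc n))" .
      show ?thesis
        unfolding bd_path_def L bd_jump_chain_case_nat y_def[symmetric]
        using n False JS by auto
    next
      case F: False
      hence "\<not> (\<exists>n. ?P n)" using n0 by (metis not0_implies_Suc)
      thus ?thesis unfolding bd_path_def using F JS False by auto
    qed
  qed
  thus ?thesis unfolding T_def y_def .
qed

text \<open>A path that has not exploded by time \<open>t\<close> visits finitely many states before. This is what allows
  the integral of \<open>V\<close> to be split at the first jump although \<open>V\<close> may be unbounded.\<close>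
lemma set_integrable_bd_path:
  fixes V :: "nat \<Rightarrow> real"
  assumes "bd_path b d x t w = Some z"
  shows "set_integrable lborel {0..t} (\<lambda>s. case_option 0 V (bd_path b d x s w))"
proof -
  obtain n where n: "t < bd_jump_time b d x w (Suc n)"
    using assms unfolding bd_path_def by (auto split: if_splits)
  define B where "B = Max ((\<lambda>k. \<bar>V (bd_jump_chain b d x w k)\<bar>) ` {..n})"
  have bound: "norm (case_option 0 V (bd_path b d x s w)) \<le> B" if "s \<in> {0..t}" for s
  proof -
    have s: "s < bd_jump_time b d x w (Suc n)" using that n by simp
    let ?k = "LEAST n. s < bd_jump_time b d x w (Suc n)"
    have "?k \<le> n" by (rule Least_le) (rule s)
    moreover have "bd_path b d x s w = Some (bd_jump_chain b d x w ?k)"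
      unfolding bd_path_def using s by auto
    ultimately show ?thesis by (auto simp: B_def intro!: Max_ge)
  qed
  have "(\<lambda>s. bd_path b d x (fst (s, w)) (snd (s, w))) \<in> borel \<rightarrow>\<^sub>M count_space UNIV"
    by (rule measurable_compose[OF _ measurable_bd_path]) (auto intro!: measurable_Pair)
  hence p: "(\<lambda>s. bd_path b d x s w) \<in> borel \<rightarrow>\<^sub>M count_space UNIV" by simp
  have [measurable]: "(\<lambda>s. case_option 0 V (bd_path b d x s w)) \<in> borel_measurable borel"
    by (rule measurable_compose[OF p]) simp
  have B: "set_integrable lborel {0..t} (\<lambda>_. B)"
    unfolding set_integrable_def
    by (intro integrable_scaleR_left integrable_real_indicator) (auto simp: emeasure_lborel_Icc_eq)
  show ?thesis
    by (rule set_integrable_bound[OF B])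
       (use bound in \<open>auto simp: set_borel_measurable_def
          intro!: AE_I2 intro: order_trans[OF _ abs_ge_self]\<close>)
qed

lemma fk_weight_case_nat:
  fixes V :: "nat \<Rightarrow> real"
  assumes T: "T = fst s / (b x + d x)" "0 \<le> T" and t: "0 \<le> t"
    and y: "y = (if snd s * (b x + d x) < b x then x + 1 else x - 1)"
  shows "fk_weight b d V x t (case_nat s w) =
    (if t < T then ennreal (exp (- V x * t))
     else ennreal (exp (- V x * T)) * fk_weight b d V y (t - T) w)"
proof -
  have path: "bd_path b d x r (case_nat s w) = (if r < T then Some x else bd_path b d y (r - T) w)" for r
    unfolding T(1) y by (rule bd_path_case_nat)
  show ?thesis
  proof (cases "t < T")
    case True
    have "(LINT r:{0..t}|lborel. case_option 0 V (bd_path b d x r (case_nat s w)))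
       = (LINT r:{0..t}|lborel. V x)"
      by (rule set_lebesgue_integral_cong) (use True in \<open>auto simp: path\<close>)
    also have "\<dots> = V x * t" using t by (simp add: set_lebesgue_integral_def mult.commute)
    finally show ?thesis using True by (simp add: fk_weight_def path)
  next
    case False
    show ?thesis
    proof (cases "bd_path b d y (t - T) w")
      case None
      thus ?thesis using False by (simp add: fk_weight_def path)
    next
      case (Some z)
      hence z: "bd_path b d x t (case_nat s w) = Some z" using False by (simp add: path)
      let ?g = "\<lambda>r. case_option 0 V (bd_path b d x r (case_nat s w))"
      note int = set_integrable_bd_path[OF z, of V]
      have "(LINT r:{0..t}|lborel. ?g r) = (LINT r:{0..<T} \<union> {T..t}|lborel. ?g r)"
        using T(2) False by (intro arg_cong2[where f = "\<lambda>A. set_lebesgue_integral lborel A"]) auto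
      also have "\<dots> = (LINT r:{0..<T}|lborel. ?g r) + (LINT r:{T..t}|lborel. ?g r)"
        using T(2) False by (intro set_integral_Un set_integrable_subset[OF int]) auto
      also have "(LINT r:{0..<T}|lborel. ?g r) = (LINT r:{0..<T}|lborel. V x)"
        by (rule set_lebesgue_integral_cong) (auto simp: path)
      also have "\<dots> = V x * T" using T(2) by (simp add: set_lebesgue_integral_def mult.commute)
      also have "(LINT r:{T..t}|lborel. ?g r)
          = (LINT r:{0..t - T}|lborel. case_option 0 V (bd_path b d y r w))"
        unfolding set_lebesgue_integral_def
        by (subst lborel_integral_real_affine[where c = 1 and t = T])
           (auto intro!: Bochner_Integration.integral_cong simp: indicator_def path)
      finally show ?thesis using False Some z
        by (simp add: fk_weight_def exp_add[symmetric] ennreal_mult[symmetric])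
    qed
  qed
qed

lemma nn_integral_exp_tail:
  fixes q a :: real
  assumes q: "0 < q"
  shows "(\<integral>\<^sup>+ t. ennreal (exp (- q * t)) * indicator {a..} t \<partial>lborel) = ennreal (exp (- q * a) / q)"
proof -
  have "(\<integral>\<^sup>+ t. ennreal (exp (- q * t)) * indicator {a..} t \<partial>lborel)
      = ennreal (0 - (- exp (- q * a) / q))"
  proof (rule nn_integral_FTC_atLeast)
    show "((\<lambda>t. - exp (- q * t) / q) has_real_derivative exp (- q * t)) (at t)" for t
      using q by (auto intro!: derivative_eq_intros)
    have "((\<lambda>t. exp (- q * t)) \<longlongrightarrow> 0) at_top"
      using q by real_asymp
    from tendsto_divide[OF tendsto_minus[OF this] tendsto_const, of q] q
    show "((\<lambda>t. - exp (- q * t) / q) \<longlongrightarrow> 0) at_top" by simp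
  qed auto
  thus ?thesis by simp
qed

text \<open>Unlike \<open>kappa_u\<close>, the time integral is taken for each starting point separately; only this weaker
  quantity satisfies an equation.\<close>
definition fk_potential ::
  "(nat \<Rightarrow> real) \<Rightarrow> (nat \<Rightarrow> real) \<Rightarrow> (nat \<Rightarrow> real) \<Rightarrow> nat \<Rightarrow> ennreal" where
  "fk_potential b d V x = (\<integral>\<^sup>+ t\<in>{0..}. bd_feynman_kac b d V t x \<partial>lborel)"

lemma bd_feynman_kac_eq: "bd_feynman_kac b d V t x = (\<integral>\<^sup>+ w. fk_weight b d V x t w \<partial>bd_noise)"
  unfolding bd_feynman_kac_def fk_weight_def ..

lemma measurable_fk_weight_section1 [measurable]:
  "fk_weight b d V x t \<in> borel_measurable bd_noise"
proof -
  have "(\<lambda>w. fk_weight b d V x (fst (t, w)) (snd (t, w))) \<in> borel_measurable bd_noise"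
    by (rule measurable_compose[OF _ measurable_fk_weight]) simp
  thus ?thesis by simp
qed

lemma measurable_fk_weight_section2 [measurable]:
  "(\<lambda>t. fk_weight b d V x t w) \<in> borel_measurable borel"
proof -
  have "(\<lambda>t. fk_weight b d V x (fst (t, w)) (snd (t, w))) \<in> borel_measurable borel"
    by (rule measurable_compose[OF _ measurable_fk_weight]) (auto intro!: measurable_Pair)
  thus ?thesis by simp
qed

lemma measurable_fk_weight_time:
  "(\<lambda>(t, w). fk_weight b d V x t w * indicator {0..} t) \<in> borel_measurable (lborel \<Otimes>\<^sub>M bd_noise)"
proof -
  have "(\<lambda>p. fk_weight b d V x (fst p) (snd p)) \<in> borel_measurable (lborel \<Otimes>\<^sub>M bd_noise)"
    using measurable_fk_weight
    by (simp add: measurable_cong_sets[OF sets_pair_measure_cong[OF sets_lborel refl] refl])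
  moreover have "(\<lambda>p. indicator {0::real..} (fst p) :: ennreal) \<in> borel_measurable (lborel \<Otimes>\<^sub>M bd_noise)"
    by (rule measurable_compose[OF measurable_fst]) (auto intro!: borel_measurable_indicator)
  ultimately show ?thesis
    by (simp add: split_beta' borel_measurable_times_ennreal)
qed

lemma fk_potential_swap:
  "fk_potential b d V x = (\<integral>\<^sup>+ w. \<integral>\<^sup>+ t. fk_weight b d V x t w * indicator {0..} t \<partial>lborel \<partial>bd_noise)"
proof -
  interpret N: prob_space bd_noise by (rule prob_space_bd_noise)
  interpret pair_sigma_finite lborel bd_noise by unfold_locales
  have "fk_potential b d V x
     = (\<integral>\<^sup>+ t. \<integral>\<^sup>+ w. fk_weight b d V x t w * indicator {0..} t \<partial>bd_noise \<partial>lborel)"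
    unfolding fk_potential_def bd_feynman_kac_eq
    by (intro nn_integral_cong nn_integral_multc[symmetric]) simp
  also have "\<dots> = (\<integral>\<^sup>+ w. \<integral>\<^sup>+ t. fk_weight b d V x t w * indicator {0..} t \<partial>lborel \<partial>bd_noise)"
    by (rule Fubini'[symmetric]) (rule measurable_fk_weight_time)
  finally show ?thesis .
qed

lemma measurable_fk_weight_total [measurable]:
  "(\<lambda>w. \<integral>\<^sup>+ t. fk_weight b d V x t w * indicator {0..} t \<partial>lborel) \<in> borel_measurable bd_noise"
  using lborel.borel_measurable_nn_integral[of "\<lambda>w t. fk_weight b d V x t w * indicator {0..} t"]
    measurable_fk_weight_time[THEN measurable_pair_swap]
  by (simp add: split_beta')

lemma fk_weight_total_case_nat:
  fixes V :: "nat \<Rightarrow> real"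
  assumes T: "T = fst s / (b x + d x)" "0 \<le> T"
    and y: "y = (if snd s * (b x + d x) < b x then x + 1 else x - 1)"
  shows "(\<integral>\<^sup>+ t. fk_weight b d V x t (case_nat s w) * indicator {0..} t \<partial>lborel)
    = (\<integral>\<^sup>+ t. ennreal (exp (- V x * t)) * indicator {0..<T} t \<partial>lborel)
      + ennreal (exp (- V x * T)) * (\<integral>\<^sup>+ t. fk_weight b d V y t w * indicator {0..} t \<partial>lborel)"
proof -
  have step: "fk_weight b d V x t (case_nat s w) =
    (if t < T then ennreal (exp (- V x * t))
     else ennreal (exp (- V x * T)) * fk_weight b d V y (t - T) w)" if "0 \<le> t" for t
    by (rule fk_weight_case_nat) (use T y that in auto)
  have "(\<integral>\<^sup>+ t. fk_weight b d V x t (case_nat s w) * indicator {0..} t \<partial>lborel)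
     = (\<integral>\<^sup>+ t. ennreal (exp (- V x * t)) * indicator {0..<T} t
          + ennreal (exp (- V x * T)) * (fk_weight b d V y (t - T) w * indicator {0..} (t - T)) \<partial>lborel)"
    using T(2) by (intro nn_integral_cong)
      (auto simp: step indicator_def)
  also have "\<dots> = (\<integral>\<^sup>+ t. ennreal (exp (- V x * t)) * indicator {0..<T} t \<partial>lborel)
      + ennreal (exp (- V x * T)) * (\<integral>\<^sup>+ t. fk_weight b d V y (t - T) w * indicator {0..} (t - T) \<partial>lborel)"
    by (subst nn_integral_add) (auto simp: nn_integral_cmult)
  also have "(\<integral>\<^sup>+ t. fk_weight b d V y (t - T) w * indicator {0..} (t - T) \<partial>lborel)
     = (\<integral>\<^sup>+ t. fk_weight b d V y t w * indicator {0..} t \<partial>lborel)"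
    using nn_integral_real_affine[of "\<lambda>t. fk_weight b d V y (t - T) w * indicator {0..} (t - T)" 1 T]
    by simp
  finally show ?thesis .
qed

lemma nn_integral_uniform_threshold:
  fixes \<beta> \<delta> :: real and g h :: ennreal
  assumes "0 < \<beta>" "0 \<le> \<delta>"
  shows "(\<integral>\<^sup>+ v. (if v * (\<beta> + \<delta>) < \<beta> then g else h) \<partial>uniform_measure lborel {0..1})
    = ennreal (\<beta> / (\<beta> + \<delta>)) * g + ennreal (\<delta> / (\<beta> + \<delta>)) * h"
proof -
  let ?p = "\<beta> / (\<beta> + \<delta>)"
  have p: "0 < ?p" "?p \<le> 1" "1 - ?p = \<delta> / (\<beta> + \<delta>)" using assms by (auto simp: field_simps)
  have iff: "v * (\<beta> + \<delta>) < \<beta> \<longleftrightarrow> v < ?p" for v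
    using assms by (simp add: pos_less_divide_eq)
  have "(\<integral>\<^sup>+ v. (if v * (\<beta> + \<delta>) < \<beta> then g else h) \<partial>uniform_measure lborel {0..1})
     = (\<integral>\<^sup>+ v. (if v * (\<beta> + \<delta>) < \<beta> then g else h) * indicator {0..1} v \<partial>lborel)"
    by (subst nn_integral_uniform_measure) (auto simp: divide_ennreal_def)
  also have "\<dots> = (\<integral>\<^sup>+ v. g * indicator {0..<?p} v + h * indicator {?p..1} v \<partial>lborel)"
    unfolding iff using p(1,2) by (intro nn_integral_cong) (auto simp: indicator_def)
  also have "\<dots> = ennreal ?p * g + ennreal (\<delta> / (\<beta> + \<delta>)) * h"
    using p by (subst nn_integral_add) (auto simp: nn_integral_cmult_indicator mult.commute)
  finally show ?thesis .
qed

text \<open>Before the first jump, at rate \<open>r = b x + d x\<close>, the weight decays at rate \<open>V x\<close>, so the first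
  holding time contributes \<open>1 / (r + V x)\<close>. The weight at the jump has expectation
  \<open>r / (r + V x)\<close>, independently of the coin that selects the neighbour. Both expectations are
  finite even for negative \<open>V x\<close> as long as \<open>q = r + V x\<close> is positive.\<close>
lemma fk_potential_first_jump:
  assumes b: "0 < b x" and d: "0 \<le> d x" and q: "0 < q" "q = b x + d x + V x"
  shows "fk_potential b d V x = ennreal (1 / q)
     + (ennreal (b x / q) * fk_potential b d V (x + 1) + ennreal (d x / q) * fk_potential b d V (x - 1))"
proof -
  define r where "r = b x + d x"
  have r: "0 < r" using b d by (simp add: r_def)
  define y where "y v = (if v * r < b x then x + 1 else x - 1)" for v
  let ?E = "density lborel (\<lambda>x. ennreal (exponential_density 1 x))"
  let ?U = "uniform_measure lborel {0..1::real}"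
  let ?K = "\<lambda>x w. \<integral>\<^sup>+ t. fk_weight b d V x t w * indicator {0..} t \<partial>lborel"
  define A where "A e = (\<integral>\<^sup>+ t. ennreal (exp (- V x * t)) * indicator {0..<e / r} t \<partial>lborel)" for e
  interpret N: prob_space bd_noise by (rule prob_space_bd_noise)
  interpret E: prob_space ?E by (rule prob_space_exponential_density) simp
  interpret U: prob_space ?U by (rule prob_space_uniform_measure) auto
  interpret EU: pair_sigma_finite ?E ?U by unfold_locales
  have K: "(\<integral>\<^sup>+ w. ?K z w \<partial>bd_noise) = fk_potential b d V z" for z
    unfolding fk_potential_swap ..
  have Ameas [measurable]: "A \<in> borel_measurable borel"
  proof -
    have "(\<lambda>(e, t). ennreal (exp (- V x * t)) * indicator {0..<e / r} t)
        \<in> borel_measurable (borel \<Otimes>\<^sub>M lborel)"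
      unfolding indicator_def atLeastLessThan_iff by measurable
    from lborel.borel_measurable_nn_integral[OF this] show ?thesis by (simp add: A_def[abs_def])
  qed
  have ymeas [measurable]: "(\<lambda>v. fk_potential b d V (y v)) \<in> borel_measurable borel"
    unfolding y_def by measurable
  have AE0: "AE e in ?E. 0 \<le> e"
    by (auto simp: AE_density exponential_density_def)
  have "fk_potential b d V x = (\<integral>\<^sup>+ s. \<integral>\<^sup>+ w. ?K x (case_nat s w) \<partial>bd_noise \<partial>clock_coin)"
    unfolding fk_potential_swap by (rule nn_integral_bd_noise_shift) measurable
  also have "\<dots> = (\<integral>\<^sup>+ s. (A (fst s) + ennreal (exp (- V x * (fst s / r))) * fk_potential b d V (y (snd s)))
       \<partial>clock_coin)"
  proof (rule nn_integral_cong_AE)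
    have "AE s in clock_coin. 0 \<le> fst s"
    proof -
      have "Measurable.pred (borel \<Otimes>\<^sub>M borel) (\<lambda>s :: real \<times> real. 0 \<le> fst s)"
        by measurable
      hence "{s \<in> space (?E \<Otimes>\<^sub>M ?U). 0 \<le> fst s} \<in> sets (?E \<Otimes>\<^sub>M ?U)"
        by (simp add: pred_def space_pair_measure cong: sets_pair_measure_cong)
      thus ?thesis
        unfolding clock_coin_def by (rule EU.AE_pair_measure) (use AE0 in auto)
    qed
    thus "AE s in clock_coin. (\<integral>\<^sup>+ w. ?K x (case_nat s w) \<partial>bd_noise)
      = A (fst s) + ennreal (exp (- V x * (fst s / r))) * fk_potential b d V (y (snd s))"
    proof eventually_elim
      case (elim s)
      have "(\<integral>\<^sup>+ w. ?K x (case_nat s w) \<partial>bd_noise)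
        = (\<integral>\<^sup>+ w. (A (fst s) + ennreal (exp (- V x * (fst s / r))) * ?K (y (snd s)) w) \<partial>bd_noise)"
        unfolding A_def using elim r
        by (intro nn_integral_cong fk_weight_total_case_nat) (auto simp: r_def y_def)
      also have "\<dots> = A (fst s) + ennreal (exp (- V x * (fst s / r))) * fk_potential b d V (y (snd s))"
        by (subst nn_integral_add) (auto simp: nn_integral_cmult K N.emeasure_space_1[simplified])
      finally show ?case .
    qed
  qed
  also have "\<dots> = (\<integral>\<^sup>+ e. \<integral>\<^sup>+ v. (A e + ennreal (exp (- V x * (e / r))) * fk_potential b d V (y v)) \<partial>?U \<partial>?E)"
    unfolding clock_coin_def by (subst U.nn_integral_fst[symmetric]) auto
  also have "\<dots> = (\<integral>\<^sup>+ e. A e + ennreal (exp (- V x * (e / r))) *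
      (\<integral>\<^sup>+ v. fk_potential b d V (y v) \<partial>?U) \<partial>?E)"
    by (intro nn_integral_cong, subst nn_integral_add) (auto simp: nn_integral_cmult U.emeasure_space_1[simplified])
  also have "\<dots> = (\<integral>\<^sup>+ e. A e \<partial>?E) + (\<integral>\<^sup>+ e. ennreal (exp (- V x * (e / r))) \<partial>?E) *
      (\<integral>\<^sup>+ v. fk_potential b d V (y v) \<partial>?U)"
    by (subst nn_integral_add) (auto simp: nn_integral_multc)
  also have "(\<integral>\<^sup>+ v. fk_potential b d V (y v) \<partial>?U)
      = ennreal (b x / r) * fk_potential b d V (x + 1) + ennreal (d x / r) * fk_potential b d V (x - 1)"
    unfolding r_def nn_integral_uniform_threshold[OF b d, symmetric]
    by (intro nn_integral_cong) (auto simp: y_def r_def)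
  also have "(\<integral>\<^sup>+ e. ennreal (exp (- V x * (e / r))) \<partial>?E) = ennreal (r / q)"
  proof -
    have "(\<integral>\<^sup>+ e. ennreal (exp (- V x * (e / r))) \<partial>?E)
       = (\<integral>\<^sup>+ e. ennreal (exp (- (q / r) * e)) * indicator {0..} e \<partial>lborel)"
      using r q by (subst nn_integral_density)
        (auto intro!: nn_integral_cong simp: exponential_density_def indicator_def r_def[symmetric]
          ennreal_mult[symmetric] exp_add[symmetric] field_simps)
    also have "\<dots> = ennreal (r / q)"
      using nn_integral_exp_tail[of "q / r" 0] r q by simp
    finally show ?thesis .
  qed
  \<comment> \<open>Exchanging the integrals replaces the clock by the probability \<open>exp (- r * t)\<close> that no jump
    has occurred by time \<open>t\<close>.\<close>
  also have "(\<integral>\<^sup>+ e. A e \<partial>?E) = ennreal (1 / q)"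
  proof -
    have "(\<integral>\<^sup>+ e. A e \<partial>?E) = (\<integral>\<^sup>+ e. \<integral>\<^sup>+ t. ennreal (exponential_density 1 e) *
        (ennreal (exp (- V x * t)) * indicator {0..<e / r} t) \<partial>lborel \<partial>lborel)"
      by (subst nn_integral_density) (auto simp: A_def nn_integral_cmult)
    also have "\<dots> = (\<integral>\<^sup>+ t. \<integral>\<^sup>+ e. ennreal (exponential_density 1 e) *
        (ennreal (exp (- V x * t)) * indicator {0..<e / r} t) \<partial>lborel \<partial>lborel)"
    proof (rule lborel_pair.Fubini'[symmetric])
      show "(\<lambda>(e, t). ennreal (exponential_density 1 e) *
          (ennreal (exp (- V x * t)) * indicator {0..<e / r} t)) \<in> borel_measurable (lborel \<Otimes>\<^sub>M lborel)"
        unfolding indicator_def atLeastLessThan_iff by measurable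
    qed
    also have "\<dots> = (\<integral>\<^sup>+ t. ennreal (exp (- q * t)) * indicator {0..} t \<partial>lborel)"
    proof (rule nn_integral_cong)
      fix t :: real
      show "(\<integral>\<^sup>+ e. ennreal (exponential_density 1 e) *
          (ennreal (exp (- V x * t)) * indicator {0..<e / r} t) \<partial>lborel)
          = ennreal (exp (- q * t)) * indicator {0..} t"
      proof (cases "0 \<le> t")
        case True
        have "(\<integral>\<^sup>+ e. ennreal (exponential_density 1 e) *
          (ennreal (exp (- V x * t)) * indicator {0..<e / r} t) \<partial>lborel)
          = (\<integral>\<^sup>+ e. ennreal (exp (- V x * t)) * (ennreal (exp (- 1 * e)) * indicator {r * t..} e) \<partial>lborel)"
        proof (rule nn_integral_cong_AE)
          have "AE e in lborel. e \<noteq> r * t" by (rule AE_lborel_singleton)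
          thus "AE e in lborel. ennreal (exponential_density 1 e) *
            (ennreal (exp (- V x * t)) * indicator {0..<e / r} t)
            = ennreal (exp (- V x * t)) * (ennreal (exp (- 1 * e)) * indicator {r * t..} e)"
          proof eventually_elim
            case (elim e)
            have "0 \<le> r * t" using r True by simp
            moreover have "t < e / r \<longleftrightarrow> r * t < e" using r by (simp add: field_simps)
            ultimately show ?case
              using True elim by (auto simp: exponential_density_def indicator_def mult.commute)
          qed
        qed
        also have "\<dots> = ennreal (exp (- V x * t)) * ennreal (exp (- (r * t)))"
          by (subst nn_integral_cmult) (use nn_integral_exp_tail[of 1 "r * t"] in auto)
        also have "\<dots> = ennreal (exp (- q * t))"
          by (simp add: ennreal_mult[symmetric] exp_add[symmetric] q(2) r_def algebra_simps)
        finally show ?thesis using True by simp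
      qed simp
    qed
    also have "\<dots> = ennreal (1 / q)" using nn_integral_exp_tail[of q 0] q by simp
    finally show ?thesis .
  qed
  also have "ennreal (r / q) * (ennreal (b x / r) * fk_potential b d V (x + 1)
       + ennreal (d x / r) * fk_potential b d V (x - 1))
     = ennreal (b x / q) * fk_potential b d V (x + 1) + ennreal (d x / q) * fk_potential b d V (x - 1)"
    using r q b d
    by (simp add: distrib_left mult.assoc[symmetric] ennreal_mult[symmetric])
  finally show ?thesis .
qed

section \<open>Lower bound of the flux by the Green kernel\<close>

text \<open>The recursion says that the slopes \<open>(S (x + 1) - S x) / m (x + 1)\<close> decrease by \<open>u x\<close>, and its
  case \<open>x = 0\<close> fixes the slope before \<open>0\<close> as \<open>S 0 / m 0\<close>. Summing twice determines \<open>S\<close> from \<open>S 0\<close>.\<close>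
lemma green_flux_explicit:
  fixes m u S :: "nat \<Rightarrow> real"
  defines "F \<equiv> \<lambda>x. \<Sum>y\<le>x. m y"
  assumes m: "\<And>x. 0 < m x"
    and S: "\<And>x. S x * (1 / m x + 1 / m (x + 1)) =
        u x + S (x + 1) / m (x + 1) + (if x = 0 then 0 else S (x - 1) / m x)"
  shows "S x = F x * (S 0 / m 0) - (\<Sum>z<x. u z * (F x - F z))"
proof -
  define E where "E x = (S (x + 1) - S x) / m (x + 1)" for x
  have E: "E x = S 0 / m 0 - (\<Sum>z\<le>x. u z)" for x
  proof (induction x)
    case 0
    show ?case using S[of 0] m[of 0] m[of 1] by (simp add: E_def field_simps)
  next
    case (Suc x)
    have "E (Suc x) = E x - u (Suc x)"
      using S[of "Suc x"] m[of "Suc x"] m[of "Suc (Suc x)"] by (simp add: E_def field_simps)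
    thus ?case using Suc by simp
  qed
  show ?thesis
  proof (induction x)
    case 0
    show ?case using m[of 0] by (simp add: F_def)
  next
    case (Suc x)
    have F: "F (Suc x) = F x + m (Suc x)" by (simp add: F_def)
    have "S (Suc x) = S x + m (Suc x) * E x" using m[of "Suc x"] by (simp add: E_def)
    also have "\<dots> = F (Suc x) * (S 0 / m 0) - ((\<Sum>z<x. u z * (F x - F z)) + m (Suc x) * (\<Sum>z\<le>x. u z))"
      unfolding E F Suc by (simp add: algebra_simps)
    also have "(\<Sum>z<x. u z * (F x - F z)) = (\<Sum>z\<le>x. u z * (F x - F z))"
      by (simp add: lessThan_Suc_atMost[symmetric])
    also have "\<dots> + m (Suc x) * (\<Sum>z\<le>x. u z) = (\<Sum>z\<le>x. u z * (F (Suc x) - F z))"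
      unfolding F by (simp add: sum_distrib_left sum.distrib[symmetric] algebra_simps)
    finally show ?case by (simp add: lessThan_Suc_atMost)
  qed
qed

text \<open>The right-hand side of \<open>green_flux_explicit\<close> at a far away \<open>N\<close> is nonnegative, which forces
  \<open>S 0 / m 0 \<ge> (\<Sum>z. u z * (1 - F z))\<close> in the limit. Inserting this at \<open>x\<close> yields the Green kernel, because
  \<open>F x * (1 - F z) - (F x - F z) = F z * (1 - F x)\<close> for \<open>z < x\<close>.\<close>
lemma green_sum_le_flux:
  fixes u S :: "nat \<Rightarrow> real" and \<mu> :: "nat pmf"
  assumes m: "\<And>x. 0 < pmf \<mu> x"
    and S: "\<And>x. S x * (1 / pmf \<mu> x + 1 / pmf \<mu> (x + 1)) =
        u x + S (x + 1) / pmf \<mu> (x + 1) + (if x = 0 then 0 else S (x - 1) / pmf \<mu> x)"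
    and S_nonneg: "\<And>x. 0 \<le> S x"
    and u: "\<And>x. 0 \<le> u x"
  shows "(\<Sum>z. ennreal (u z * (pmf_cdf \<mu> (min x z) * (1 - pmf_cdf \<mu> (max x z))))) \<le> ennreal (S x)"
proof -
  define F where "F = pmf_cdf \<mu>"
  have F: "0 \<le> F z" "F z \<le> 1" for z by (simp_all add: F_def pmf_cdf_nonneg pmf_cdf_le_1)
  define c where "c = S 0 / pmf \<mu> 0"
  have expl: "S x = F x * c - (\<Sum>z<x. u z * (F x - F z))" for x
    unfolding F_def pmf_cdf_def c_def
    by (rule green_flux_explicit) (fact m, fact S)
  have lim: "F x * (\<Sum>z<M. u z * (1 - F z)) \<le> F x * c" for M
  proof (rule mult_left_mono)
    have "(\<lambda>N. \<Sum>z<M. u z * (F N - F z)) \<longlonglongrightarrow> (\<Sum>z<M. u z * (1 - F z))"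
      using pmf_cdf_tendsto_1[of \<mu>] unfolding F_def by (intro tendsto_intros)
    moreover have "(\<lambda>N. F N * c) \<longlonglongrightarrow> 1 * c"
      using pmf_cdf_tendsto_1[of \<mu>] unfolding F_def by (intro tendsto_intros)
    moreover have "\<forall>N\<ge>M. (\<Sum>z<M. u z * (F N - F z)) \<le> F N * c"
    proof (intro allI impI)
      fix N assume "M \<le> N"
      hence "(\<Sum>z<M. u z * (F N - F z)) \<le> (\<Sum>z<N. u z * (F N - F z))"
        using u pmf_cdf_mono[of _ N \<mu>] by (intro sum_mono2) (auto simp: F_def)
      also have "\<dots> \<le> F N * c" using expl[of N] S_nonneg[of N] by simp
      finally show "(\<Sum>z<M. u z * (F N - F z)) \<le> F N * c" .
    qed
    ultimately show "(\<Sum>z<M. u z * (1 - F z)) \<le> c"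
      using LIMSEQ_le by fastforce
  qed (rule F)
  have part: "(\<Sum>z<M. u z * (F (min x z) * (1 - F (max x z)))) \<le> S x" if "x \<le> M" for M
  proof -
    have "(\<Sum>z<x. u z * (F x - F z)) = (\<Sum>z<M. if z < x then u z * (F x - F z) else 0)"
      by (rule sum.mono_neutral_cong_left) (use that in auto)
    hence "(\<Sum>z<M. u z * (F (min x z) * (1 - F (max x z))))
      = F x * (\<Sum>z<M. u z * (1 - F z)) - (\<Sum>z<x. u z * (F x - F z))"
      by (simp add: sum_distrib_left sum_subtractf[symmetric])
         (intro sum.cong, auto simp: min_def max_def algebra_simps)
    also have "\<dots> \<le> S x" using lim[of M] expl[of x] by simp
    finally show ?thesis .
  qed
  have nn: "0 \<le> u z * (F (min x z) * (1 - F (max x z)))" for z using u F by simp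
  have "(\<Sum>z<M. ennreal (u z * (F (min x z) * (1 - F (max x z))))) \<le> ennreal (S x)" for M
  proof -
    have "(\<Sum>z<M. u z * (F (min x z) * (1 - F (max x z))))
        \<le> (\<Sum>z<max x M. u z * (F (min x z) * (1 - F (max x z))))"
      using nn by (intro sum_mono2) auto
    also have "\<dots> \<le> S x" by (rule part) simp
    finally show ?thesis using nn by (subst sum_ennreal) (auto intro: ennreal_leI)
  qed
  thus ?thesis unfolding F_def by (intro suminf_le_const) auto
qed

lemma
  assumes irr: "bd_irreducible lam nu" and rec: "bd_positive_recurrent lam nu"
  shows pmf_bd_stationary_pos: "0 < pmf (bd_stationary lam nu) x"
    and bd_stationary_reversible: "lam x * pmf (bd_stationary lam nu) x
          = nu (x + 1) * pmf (bd_stationary lam nu) (x + 1)"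
proof -
  let ?w = "bd_weight lam nu"
  have pos: "0 < ?w y" for y
    using irr by (auto simp: bd_weight_def bd_irreducible_def intro!: prod_pos)
  have "summable ?w"
    using rec by (simp add: bd_positive_recurrent_def summable_Suc_iff)
  hence "0 < (\<Sum>y. ?w y)" using suminf_pos pos by blast
  thus "0 < pmf (bd_stationary lam nu) x"
    using pos by (simp add: pmf_bd_stationary[OF irr rec])
  have "?w (x + 1) = ?w x * (lam x / nu (x + 1))" by (simp add: bd_weight_def)
  moreover have "0 < nu (x + 1)" using irr by (simp add: bd_irreducible_def)
  ultimately show "lam x * pmf (bd_stationary lam nu) x
      = nu (x + 1) * pmf (bd_stationary lam nu) (x + 1)"
    by (simp add: pmf_bd_stationary[OF irr rec])
qed

text \<open>Multiplying the first-jump equation by \<open>u x\<close> removes the ratios of \<open>u\<close> from the modified rates;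
  passing to the flux \<open>S\<close> and using reversibility removes \<open>lam\<close> and \<open>nu\<close> as well.\<close>
lemma fk_potential_flux_recursion:
  fixes lam nu u :: "nat \<Rightarrow> real" and \<mu> :: "nat pmf"
  defines "H \<equiv> \<lambda>x. enn2real (fk_potential (birth_u lam u) (death_u nu u) (potential_u lam nu u) x)"
  defines "S \<equiv> \<lambda>x. lam x * pmf \<mu> x * u x * H x"
  assumes irr: "bd_irreducible lam nu" and u: "\<And>x. 0 < u x"
    and m: "\<And>x. 0 < pmf \<mu> x"
    and rev: "\<And>x. lam x * pmf \<mu> x = nu (x + 1) * pmf \<mu> (x + 1)"
    and fin: "\<And>x. fk_potential (birth_u lam u) (death_u nu u) (potential_u lam nu u) x < \<infinity>"
  shows "S x * (1 / pmf \<mu> x + 1 / pmf \<mu> (x + 1)) =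
     u x + S (x + 1) / pmf \<mu> (x + 1) + (if x = 0 then 0 else S (x - 1) / pmf \<mu> x)"
proof -
  let ?b = "birth_u lam u" and ?d = "death_u nu u" and ?V = "potential_u lam nu u"
  define q where "q = nu (x + 1) + lam x"
  have lam: "0 < lam x" for x using irr by (simp add: bd_irreducible_def)
  have nu: "0 \<le> nu x" "0 < nu (x + 1)" "nu 0 = 0" for x
    using irr by (cases x; auto simp: bd_irreducible_def less_imp_le)+
  have b: "0 < ?b x" and d: "0 \<le> ?d x"
    using u lam nu by (auto simp: birth_u_def death_u_def less_imp_le)
  have q: "0 < q" "q = ?b x + ?d x + ?V x"
    using lam[of x] nu(2)[of x] by (auto simp: q_def potential_u_def)
  have H: "fk_potential ?b ?d ?V x = ennreal (H x)" "0 \<le> H x" for x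
    using fin[of x] by (auto simp: H_def less_top)
  have nonneg: "0 \<le> 1 / q" "0 \<le> ?b x / q" "0 \<le> ?d x / q" using q(1) b d by auto
  have "ennreal (H x) = ennreal (1 / q + (?b x / q * H (x + 1) + ?d x / q * H (x - 1)))"
    using fk_potential_first_jump[where b = ?b and d = ?d and V = ?V and x = x and q = q, OF b d q]
      nonneg H(2)
    unfolding H(1) by (simp only: ennreal_mult ennreal_plus mult_nonneg_nonneg add_nonneg_nonneg)
  hence "H x = 1 / q + (?b x / q * H (x + 1) + ?d x / q * H (x - 1))"
    by (rule ennreal_inj[THEN iffD1, rotated 2]) (use q b d H(2) in auto)
  hence "q * H x = 1 + (?b x * H (x + 1) + ?d x * H (x - 1))"
    using q(1) by (simp add: field_simps)
  hence "u x * (q * H x) = u x * (1 + (?b x * H (x + 1) + ?d x * H (x - 1)))" by simp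
  hence rec: "nu (x + 1) * u x * H x + lam x * u x * H x
     = u x + lam (x + 1) * u (x + 1) * H (x + 1) + nu x * u (x - 1) * H (x - 1)"
    using u[of x] by (simp add: q_def birth_u_def death_u_def algebra_simps)
  have S1: "S y / pmf \<mu> y = lam y * u y * H y" for y
    using m[of y] by (simp add: S_def)
  have S2: "S y / pmf \<mu> (y + 1) = nu (y + 1) * u y * H y" for y
    using m[of "y + 1"] unfolding S_def rev by simp
  have S3: "(if x = 0 then 0 else S (x - 1) / pmf \<mu> x) = nu x * u (x - 1) * H (x - 1)"
    using S2[of "x - 1"] nu(3) by (cases x) auto
  have "S x * (1 / pmf \<mu> x + 1 / pmf \<mu> (x + 1)) = S x / pmf \<mu> x + S x / pmf \<mu> (x + 1)"
    by (simp add: distrib_left)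
  thus ?thesis unfolding S1 S2 S3 using rec by simp
qed

section \<open>Weighted isoperimetric inequality\<close>

lemma measure_pmf_eq_density_pmf_density:
  assumes ac: "absolutely_continuous (measure_pmf \<mu>) (measure_pmf \<pi>)"
  shows "measure_pmf \<pi> = density (measure_pmf \<mu>) (\<lambda>x. ennreal (pmf_density \<mu> \<pi> x))"
proof -
  have "AE x in measure_pmf \<mu>. RN_deriv (measure_pmf \<mu>) (measure_pmf \<pi>) x \<noteq> \<infinity>"
    by (rule measure_pmf.RN_deriv_finite[OF _ ac]) (auto intro: measure_pmf.sigma_finite_measure_axioms)
  hence "AE x in measure_pmf \<mu>. RN_deriv (measure_pmf \<mu>) (measure_pmf \<pi>) x = ennreal (pmf_density \<mu> \<pi> x)"
    by eventually_elim (simp add: pmf_density_def less_top)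
  hence "density (measure_pmf \<mu>) (RN_deriv (measure_pmf \<mu>) (measure_pmf \<pi>))
      = density (measure_pmf \<mu>) (\<lambda>x. ennreal (pmf_density \<mu> \<pi> x))"
    by (intro density_cong) auto
  thus ?thesis using measure_pmf.density_RN_deriv[OF ac] by simp
qed

lemma pmf_density_nonneg: "0 \<le> pmf_density \<mu> \<pi> x"
  by (simp add: pmf_density_def)

lemma nn_integral_measure_pmf_nat:
  fixes \<mu> :: "nat pmf"
  assumes "\<And>x. 0 \<le> h x"
  shows "(\<integral>\<^sup>+ x. ennreal (h x) \<partial>measure_pmf \<mu>) = (\<Sum>x. ennreal (pmf \<mu> x * h x))"
  using assms by (simp add: nn_integral_measure_pmf nn_integral_count_space_nat ennreal_mult)

lemma fk_potential_le_kappa: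
  "fk_potential (birth_u lam u) (death_u nu u) (potential_u lam nu u) x \<le> kappa_u lam nu u"
  unfolding fk_potential_def kappa_u_def
  by (intro nn_integral_mono mult_right_mono SUP_upper) auto

lemma kappa_u_pos:
  assumes "bd_irreducible lam nu" "\<And>x. 0 < u x"
  shows "0 < kappa_u lam nu u"
proof -
  let ?b = "birth_u lam u" and ?d = "death_u nu u" and ?V = "potential_u lam nu u"
  have p: "0 < lam x" "0 < nu (x + 1)" for x using assms(1) by (auto simp: bd_irreducible_def)
  have "0 < ?b 0" "0 \<le> ?d 0" using assms p by (auto simp: birth_u_def death_u_def bd_irreducible_def)
  moreover have q: "0 < nu (0 + 1) + lam 0" using p[of 0] by simp
  moreover have "nu (0 + 1) + lam 0 = ?b 0 + ?d 0 + ?V 0" by (simp add: potential_u_def)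
  ultimately have "fk_potential ?b ?d ?V 0 \<ge> ennreal (1 / (nu (0 + 1) + lam 0))"
    by (subst fk_potential_first_jump) auto
  moreover have "0 < ennreal (1 / (nu (0 + 1) + lam 0))" using q by simp
  ultimately show ?thesis using fk_potential_le_kappa[of lam u nu 0] by (meson less_le_trans)
qed

text \<open>Densities of infinite energy are included, since a finite information controls the energy of
  the square root only.\<close>
lemma weighted_isoperimetry:
  fixes lam nu rho u :: "nat \<Rightarrow> real"
  assumes irr: "bd_irreducible lam nu" and rec: "bd_positive_recurrent lam nu"
    and mu: "\<mu> = bd_stationary lam nu"
    and rho: "strict_mono rho" and u: "u = (\<lambda>x. rho (x + 1) - rho x)"
    and fin: "kappa_u lam nu u < \<infinity>"
    and ac: "absolutely_continuous (measure_pmf \<mu>) (measure_pmf \<pi>)"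
  shows "wasserstein (\<lambda>x y. \<bar>rho x - rho y\<bar>) \<pi> \<mu>
    \<le> kappa_u lam nu u * (\<integral>\<^sup>+ x. ennreal (lam x * u x * \<bar>fdiff (pmf_density \<mu> \<pi>) x\<bar>) \<partial>measure_pmf \<mu>)"
proof -
  let ?\<kappa> = "kappa_u lam nu u"
  let ?f = "pmf_density \<mu> \<pi>"
  define H where "H x = enn2real (fk_potential (birth_u lam u) (death_u nu u) (potential_u lam nu u) x)" for x
  define S where "S x = lam x * pmf \<mu> x * u x * H x" for x
  have u_pos: "0 < u x" for x using strict_monoD[OF rho, of x "x + 1"] by (simp add: u)
  have lam: "0 < lam x" for x using irr by (simp add: bd_irreducible_def)
  note m = pmf_bd_stationary_pos[OF irr rec, folded mu]
  note rev = bd_stationary_reversible[OF irr rec, folded mu]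
  have fk_fin: "fk_potential (birth_u lam u) (death_u nu u) (potential_u lam nu u) x < \<infinity>" for x
    using fk_potential_le_kappa fin by (rule le_less_trans)
  have H: "0 \<le> H x" "ennreal (H x) \<le> ?\<kappa>" for x
    using fk_potential_le_kappa[of lam u nu x] fk_fin[of x] by (auto simp: H_def less_top)
  have S0: "0 \<le> S x" for x using lam[of x] u_pos[of x] H(1)[of x] by (simp add: S_def)
  have flux: "S x * (1 / pmf \<mu> x + 1 / pmf \<mu> (x + 1)) =
     u x + S (x + 1) / pmf \<mu> (x + 1) + (if x = 0 then 0 else S (x - 1) / pmf \<mu> x)" for x
    unfolding S_def H_def by (rule fk_potential_flux_recursion[OF irr u_pos m rev fk_fin])
  have green: "(\<Sum>z. ennreal (u z * (pmf_cdf \<mu> (min x z) * (1 - pmf_cdf \<mu> (max x z))))) \<le> ennreal (S x)" for x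
    using green_sum_le_flux[OF m flux S0] u_pos by (simp add: less_imp_le)
  have "wasserstein (\<lambda>x y. \<bar>rho x - rho y\<bar>) \<pi> \<mu> \<le> (\<Sum>x. ennreal \<bar>fdiff ?f x\<bar> * ennreal (S x))"
    by (rule wasserstein_le_weighted_increments)
       (use rho green in \<open>auto simp: u strict_mono_mono pmf_density_nonneg
          intro: measure_pmf_eq_density_pmf_density[OF ac]\<close>)
  also have "\<dots> \<le> (\<Sum>x. ?\<kappa> * ennreal (pmf \<mu> x * (lam x * u x * \<bar>fdiff ?f x\<bar>)))"
  proof (intro suminf_le allI)
    fix x
    have "ennreal \<bar>fdiff ?f x\<bar> * ennreal (S x)
       = ennreal (H x) * ennreal (pmf \<mu> x * (lam x * u x * \<bar>fdiff ?f x\<bar>))"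
      using lam[of x] u_pos[of x] H(1)[of x]
      by (simp add: S_def ennreal_mult[symmetric] mult_ac)
    also have "\<dots> \<le> ?\<kappa> * ennreal (pmf \<mu> x * (lam x * u x * \<bar>fdiff ?f x\<bar>))"
      by (intro mult_right_mono H) auto
    finally show "ennreal \<bar>fdiff ?f x\<bar> * ennreal (S x)
      \<le> ?\<kappa> * ennreal (pmf \<mu> x * (lam x * u x * \<bar>fdiff ?f x\<bar>))" .
  qed auto
  also have "\<dots> = ?\<kappa> * (\<integral>\<^sup>+ x. ennreal (lam x * u x * \<bar>fdiff ?f x\<bar>) \<partial>measure_pmf \<mu>)"
    using lam u_pos by (subst nn_integral_measure_pmf_nat) (auto simp: less_imp_le ennreal_suminf_cmult)
  finally show ?thesis .
qed

section \<open>Transport-information inequality\<close>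

text \<open>For \<open>a > 0\<close> the hypothesis says that \<open>I\<close> is at least the positive root of
  \<open>a * I\<^sup>2 + b * I = s\<^sup>2\<close>, namely \<open>(sqrt (b\<^sup>2 + 4 * a * s\<^sup>2) - b) / (2 * a)\<close>; the deviation term has the
  smaller factor \<open>2\<close> in place of \<open>4\<close>.\<close>
lemma dev_term_le:
  assumes "0 \<le> a" "0 < b" "0 \<le> I" "s\<^sup>2 \<le> I * (b + a * I)"
  shows "dev_term a b s \<le> I"
proof (cases "a = 0")
  case True
  have "s\<^sup>2 \<le> I * b" using assms True by simp
  also have "\<dots> \<le> I * (2 * b)" using assms by simp
  finally show ?thesis using True assms by (simp add: dev_term_def divide_le_eq)
next
  case False
  hence a: "0 < a" using assms by simp
  have "sqrt (b\<^sup>2 + 2 * a * s\<^sup>2) \<le> b + 2 * a * I"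
  proof (rule real_le_lsqrt)
    have "2 * a * s\<^sup>2 \<le> 2 * a * (I * (b + a * I))" using a assms by simp
    moreover have "0 \<le> b * a * I" "0 \<le> (a * I)\<^sup>2" using a assms by auto
    ultimately show "b\<^sup>2 + 2 * a * s\<^sup>2 \<le> (b + 2 * a * I)\<^sup>2"
      by (simp add: power2_eq_square algebra_simps)
  qed (use a assms in auto)
  thus ?thesis using a by (simp add: dev_term_def field_simps)
qed

text \<open>With \<open>U x = \<theta> ^ x\<close> the bracket in the Lyapunov condition is \<open>(L U / U) x\<close>, and the energy of
  \<open>g\<close> dominates the integral of \<open>- (L U / U) * g\<^sup>2\<close>: along the edge \<open>{x, x + 1}\<close> this is
  \<open>2 * p * q \<le> \<theta> * p\<^sup>2 + q\<^sup>2 / \<theta>\<close>. The integrals may diverge separately, so all sums are cut at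
  \<open>N\<close>; the boundary term left over from the energy has the right sign because \<open>\<theta> > 1\<close>.\<close>
lemma lyapunov_energy_bound:
  fixes lam nu u g m :: "nat \<Rightarrow> real"
  assumes ly: "lyapunov_cond lam nu u \<epsilon> \<theta> a b"
    and lam: "\<And>x. 0 \<le> lam x" and nu: "nu 0 = 0" and m: "\<And>x. 0 \<le> m x"
    and rev: "\<And>x. lam x * m x = nu (x + 1) * m (x + 1)"
    and mass: "(\<Sum>x\<le>N. m x * (g x)\<^sup>2) \<le> 1"
  shows "(\<Sum>x<N. lam x * m x * (u x)\<^sup>2 * (g x + g (x + 1))\<^sup>2)
    \<le> b + a * (\<Sum>x<N. lam x * m x * (fdiff g x)\<^sup>2)"
proof -
  from ly have e: "0 < \<epsilon>" "1 < \<theta>" "0 \<le> a" "0 < b"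
    and L: "\<And>x. (1 + \<epsilon>) * lam x * (u x)\<^sup>2 + (1 + 1 / \<epsilon>) * nu x * (u (x - 1))\<^sup>2
          \<le> - a * (lam x * (\<theta> - 1) + nu x * (1 / \<theta> - 1)) + b"
    unfolding lyapunov_cond_def by auto
  have young: "2 * p * q \<le> t * p\<^sup>2 + q\<^sup>2 / t" if "0 < t" for p q t :: real
  proof -
    have "0 \<le> (t * p - q)\<^sup>2 / t" using that by simp
    also have "\<dots> = t * p\<^sup>2 + q\<^sup>2 / t - 2 * p * q"
      using that by (simp add: power2_eq_square field_simps)
    finally show ?thesis by simp
  qed
  \<comment> \<open>Reversibility moves the weight of an edge to its upper end point, see \<open>shift\<close>; \<open>stay\<close> keeps it
    at the lower one.\<close>
  have shift: "(\<Sum>x<N. lam x * m x * k x * (g (x + 1))\<^sup>2) = (\<Sum>x\<le>N. m x * (g x)\<^sup>2 * (nu x * k (x - 1)))" for k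
  proof -
    have "(\<Sum>x\<le>N. m x * (g x)\<^sup>2 * (nu x * k (x - 1)))
       = (\<Sum>x<N. m (Suc x) * (g (Suc x))\<^sup>2 * (nu (Suc x) * k x))"
      unfolding lessThan_Suc_atMost[symmetric] sum.lessThan_Suc_shift using nu by simp
    also have "\<dots> = (\<Sum>x<N. lam x * m x * k x * (g (x + 1))\<^sup>2)"
      by (intro sum.cong) (auto simp: rev mult_ac)
    finally show ?thesis ..
  qed
  have stay: "(\<Sum>x<N. lam x * m x * k x * (g x)\<^sup>2) = (\<Sum>x\<le>N. m x * (g x)\<^sup>2 * (lam x * k x))
      - lam N * m N * k N * (g N)\<^sup>2" for k
    unfolding lessThan_Suc_atMost[symmetric] by (simp add: mult_ac)
  have "(\<Sum>x<N. lam x * m x * (u x)\<^sup>2 * (g x + g (x + 1))\<^sup>2)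
     \<le> (\<Sum>x<N. lam x * m x * ((1 + \<epsilon>) * (u x)\<^sup>2) * (g x)\<^sup>2
           + lam x * m x * ((1 + 1 / \<epsilon>) * (u x)\<^sup>2) * (g (x + 1))\<^sup>2)"
  proof (rule sum_mono)
    fix x
    have "(g x + g (x + 1))\<^sup>2 \<le> (1 + \<epsilon>) * (g x)\<^sup>2 + (1 + 1 / \<epsilon>) * (g (x + 1))\<^sup>2"
      using young[OF e(1), of "g x" "g (x + 1)"] by (simp add: power2_sum algebra_simps)
    hence "lam x * m x * (u x)\<^sup>2 * (g x + g (x + 1))\<^sup>2
      \<le> lam x * m x * (u x)\<^sup>2 * ((1 + \<epsilon>) * (g x)\<^sup>2 + (1 + 1 / \<epsilon>) * (g (x + 1))\<^sup>2)"
      using lam m by (intro mult_left_mono) auto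
    thus "lam x * m x * (u x)\<^sup>2 * (g x + g (x + 1))\<^sup>2
      \<le> lam x * m x * ((1 + \<epsilon>) * (u x)\<^sup>2) * (g x)\<^sup>2
           + lam x * m x * ((1 + 1 / \<epsilon>) * (u x)\<^sup>2) * (g (x + 1))\<^sup>2"
      by (simp add: algebra_simps)
  qed
  also have "\<dots> \<le> (\<Sum>x\<le>N. m x * (g x)\<^sup>2 *
      ((1 + \<epsilon>) * lam x * (u x)\<^sup>2 + (1 + 1 / \<epsilon>) * nu x * (u (x - 1))\<^sup>2))"
  proof -
    have "0 \<le> lam N * m N * ((1 + \<epsilon>) * (u N)\<^sup>2) * (g N)\<^sup>2" using lam m e by simp
    moreover have split: "(\<Sum>x\<le>N. m x * (g x)\<^sup>2 *
        ((1 + \<epsilon>) * lam x * (u x)\<^sup>2 + (1 + 1 / \<epsilon>) * nu x * (u (x - 1))\<^sup>2))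
      = (\<Sum>x\<le>N. m x * (g x)\<^sup>2 * (lam x * ((1 + \<epsilon>) * (u x)\<^sup>2)))
        + (\<Sum>x\<le>N. m x * (g x)\<^sup>2 * (nu x * ((1 + 1 / \<epsilon>) * (u (x - 1))\<^sup>2)))"
      unfolding sum.distrib[symmetric] by (intro sum.cong refl) (simp add: algebra_simps)
    ultimately show ?thesis
      unfolding sum.distrib stay shift split by linarith
  qed
  also have "\<dots> \<le> (\<Sum>x\<le>N. m x * (g x)\<^sup>2 * (- a * (lam x * (\<theta> - 1) + nu x * (1 / \<theta> - 1)) + b))"
    using m L by (intro sum_mono mult_left_mono) auto
  also have "\<dots> = b * (\<Sum>x\<le>N. m x * (g x)\<^sup>2) + a * ((\<Sum>x\<le>N. m x * (g x)\<^sup>2 * (lam x * (1 - \<theta>)))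
       + (\<Sum>x\<le>N. m x * (g x)\<^sup>2 * (nu x * (1 - 1 / \<theta>))))"
    by (simp add: sum_distrib_left sum.distrib[symmetric] algebra_simps)
  also have "\<dots> \<le> b * 1 + a * (\<Sum>x<N. lam x * m x * (fdiff g x)\<^sup>2)"
  proof (intro add_mono mult_left_mono)
    have "(\<Sum>x\<le>N. m x * (g x)\<^sup>2 * (lam x * (1 - \<theta>))) + (\<Sum>x\<le>N. m x * (g x)\<^sup>2 * (nu x * (1 - 1 / \<theta>)))
      = (\<Sum>x<N. lam x * m x * ((1 - \<theta>) * (g x)\<^sup>2 + (1 - 1 / \<theta>) * (g (x + 1))\<^sup>2))
         + lam N * m N * (1 - \<theta>) * (g N)\<^sup>2"
      using stay[of "\<lambda>_. 1 - \<theta>"] shift[of "\<lambda>_. 1 - 1 / \<theta>"]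
      by (simp add: distrib_left sum.distrib mult.assoc)
    also have "\<dots> \<le> (\<Sum>x<N. lam x * m x * (fdiff g x)\<^sup>2) + 0"
    proof (intro add_mono sum_mono mult_left_mono)
      fix x
      show "(1 - \<theta>) * (g x)\<^sup>2 + (1 - 1 / \<theta>) * (g (x + 1))\<^sup>2 \<le> (fdiff g x)\<^sup>2"
        using young[of \<theta> "g x" "g (x + 1)"] e
        by (simp add: fdiff_def power2_diff algebra_simps)
      show "lam N * m N * (1 - \<theta>) * (g N)\<^sup>2 \<le> 0"
        using lam m e by (simp add: mult_nonneg_nonpos mult_nonpos_nonneg)
    qed (use lam m in auto)
    finally show "(\<Sum>x\<le>N. m x * (g x)\<^sup>2 * (lam x * (1 - \<theta>))) + (\<Sum>x\<le>N. m x * (g x)\<^sup>2 * (nu x * (1 - 1 / \<theta>)))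
      \<le> (\<Sum>x<N. lam x * m x * (fdiff g x)\<^sup>2)" by simp
  qed (use mass e in auto)
  finally show ?thesis by simp
qed

lemma weighted_increments_le_information:
  fixes lam nu u f m :: "nat \<Rightarrow> real"
  assumes ly: "lyapunov_cond lam nu u \<epsilon> \<theta> a b"
    and lam: "\<And>x. 0 \<le> lam x" and nu: "nu 0 = 0" and m: "\<And>x. 0 \<le> m x" and f: "\<And>x. 0 \<le> f x"
    and rev: "\<And>x. lam x * m x = nu (x + 1) * m (x + 1)"
    and mass: "(\<Sum>x\<le>N. m x * f x) \<le> 1"
    and info: "(\<Sum>x<N. lam x * m x * (fdiff (\<lambda>x. sqrt (f x)) x)\<^sup>2) \<le> I"
  shows "(\<Sum>x<N. lam x * m x * u x * \<bar>fdiff f x\<bar>)\<^sup>2 \<le> I * (b + a * I)"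
proof -
  define g where "g x = sqrt (f x)" for x
  have g: "0 \<le> g x" "(g x)\<^sup>2 = f x" for x using f by (auto simp: g_def)
  have a: "0 \<le> a" "0 < b" using ly by (auto simp: lyapunov_cond_def)
  let ?E = "\<Sum>x<N. lam x * m x * (fdiff g x)\<^sup>2"
  let ?Q = "\<Sum>x<N. lam x * m x * (u x)\<^sup>2 * (g x + g (x + 1))\<^sup>2"
  have E: "?E \<le> I" using info by (simp add: g_def[abs_def])
  have E0: "0 \<le> ?E" using lam m by (intro sum_nonneg) auto
  have "\<bar>fdiff f x\<bar> = \<bar>fdiff g x\<bar> * (g x + g (x + 1))" for x
  proof -
    have "fdiff f x = fdiff g x * (g x + g (x + 1))"
      by (simp add: fdiff_def g(2)[symmetric] power2_eq_square algebra_simps)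
    thus ?thesis using g(1)[of x] g(1)[of "x + 1"] by (simp add: abs_mult)
  qed
  hence "(\<Sum>x<N. lam x * m x * u x * \<bar>fdiff f x\<bar>)
     = (\<Sum>x<N. (sqrt (lam x * m x) * \<bar>fdiff g x\<bar>) * (sqrt (lam x * m x) * u x * (g x + g (x + 1))))"
    using lam m by (intro sum.cong refl) (simp add: algebra_simps flip: real_sqrt_mult power2_eq_square)
  hence "(\<Sum>x<N. lam x * m x * u x * \<bar>fdiff f x\<bar>)\<^sup>2
     \<le> (\<Sum>x<N. (sqrt (lam x * m x) * \<bar>fdiff g x\<bar>)\<^sup>2) * (\<Sum>x<N. (sqrt (lam x * m x) * u x * (g x + g (x + 1)))\<^sup>2)"
    using Cauchy_Schwarz_ineq_sum[of "\<lambda>x. sqrt (lam x * m x) * \<bar>fdiff g x\<bar>"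
        "\<lambda>x. sqrt (lam x * m x) * u x * (g x + g (x + 1))" "{..<N}"]
    by simp
  also have "\<dots> = ?E * ?Q"
    using lam m by (simp add: power_mult_distrib)
  also have "?E * ?Q \<le> I * (b + a * I)"
  proof (rule mult_mono)
    have "?Q \<le> b + a * ?E"
      by (rule lyapunov_energy_bound[OF ly lam nu m rev]) (use mass in \<open>simp add: g\<close>)
    also have "\<dots> \<le> b + a * I" using E a by (simp add: mult_left_mono)
    finally show "?Q \<le> b + a * I" .
    show "0 \<le> ?Q" using lam m by (intro sum_nonneg) auto
  qed (use E E0 in auto)
  finally show ?thesis .
qed

text \<open>The bounds on partial sums are uniform in the cut-off, so they pass to the weighted isoperimetric
  inequality; this also shows that the distance is finite as soon as the information is.\<close>
lemma transport_information:
  fixes lam nu rho u :: "nat \<Rightarrow> real"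
  assumes irr: "bd_irreducible lam nu" and rec: "bd_positive_recurrent lam nu"
    and mu: "\<mu> = bd_stationary lam nu"
    and rho: "strict_mono rho" and u: "u = (\<lambda>x. rho (x + 1) - rho x)"
    and fin: "kappa_u lam nu u < \<infinity>"
    and ac: "absolutely_continuous (measure_pmf \<mu>) (measure_pmf \<pi>)"
  shows "deviation lam nu u (wasserstein (\<lambda>x y. \<bar>rho x - rho y\<bar>) \<pi> \<mu>) \<le> fdv_information lam \<pi> \<mu>"
proof (cases "(\<lambda>x. sqrt (pmf_density \<mu> \<pi> x)) \<in> dirichlet_dom lam \<mu>")
  case False
  thus ?thesis by (simp add: fdv_information_def)
next
  case True
  let ?\<kappa> = "kappa_u lam nu u" and ?W = "wasserstein (\<lambda>x y. \<bar>rho x - rho y\<bar>) \<pi> \<mu>"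
  let ?f = "pmf_density \<mu> \<pi>"
  define g where "g x = sqrt (?f x)" for x
  define I where "I = dirichlet lam \<mu> g g"
  have info: "fdv_information lam \<pi> \<mu> = ennreal I"
    using True by (simp add: fdv_information_def Let_def I_def g_def[abs_def])
  have lam: "0 < lam x" for x using irr by (simp add: bd_irreducible_def)
  have nu0: "nu 0 = 0" using irr by (simp add: bd_irreducible_def)
  have u_pos: "0 < u x" for x using strict_monoD[OF rho, of x "x + 1"] by (simp add: u)
  note rev = bd_stationary_reversible[OF irr rec, folded mu]
  note dens = measure_pmf_eq_density_pmf_density[OF ac]
  have I0: "0 \<le> I" unfolding I_def dirichlet_def
    by (rule Bochner_Integration.integral_nonneg) (use lam in \<open>simp add: less_imp_le mult.assoc\<close>)
  have mass: "(\<Sum>x\<le>N. pmf \<mu> x * ?f x) \<le> 1" for N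
  proof -
    have "(\<Sum>x\<le>N. ennreal (pmf \<mu> x * ?f x)) \<le> (\<Sum>x. ennreal (pmf \<mu> x * ?f x))"
      by (rule sum_le_suminf) auto
    also have "\<dots> = (\<integral>\<^sup>+ x. ennreal (?f x) \<partial>measure_pmf \<mu>)"
      by (rule nn_integral_measure_pmf_nat[symmetric]) (rule pmf_density_nonneg)
    also have "\<dots> = emeasure (density (measure_pmf \<mu>) (\<lambda>x. ennreal (?f x))) UNIV"
      by (simp add: emeasure_density)
    also have "\<dots> = 1" unfolding dens[symmetric] by simp
    finally show ?thesis by (subst (asm) sum_ennreal) (auto simp: pmf_density_nonneg)
  qed
  have energy: "(\<Sum>x<N. lam x * pmf \<mu> x * (fdiff g x)\<^sup>2) \<le> I" for N
  proof -
    have "(\<Sum>x<N. ennreal (pmf \<mu> x * (lam x * fdiff g x * fdiff g x)))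
        \<le> (\<Sum>x. ennreal (pmf \<mu> x * (lam x * fdiff g x * fdiff g x)))"
      by (rule sum_le_suminf) auto
    also have "\<dots> = (\<integral>\<^sup>+ x. ennreal (lam x * fdiff g x * fdiff g x) \<partial>measure_pmf \<mu>)"
      using lam by (intro nn_integral_measure_pmf_nat[symmetric]) (simp add: less_imp_le mult.assoc)
    also have "\<dots> = ennreal I" unfolding I_def dirichlet_def
      using True lam
      by (intro nn_integral_eq_integral) (auto simp: dirichlet_dom_def g_def[abs_def] less_imp_le mult.assoc)
    finally have "ennreal (\<Sum>x<N. pmf \<mu> x * (lam x * fdiff g x * fdiff g x)) \<le> ennreal I"
      using lam by (subst (asm) sum_ennreal) (auto simp: less_imp_le mult.assoc)
    thus ?thesis using I0 by (simp add: power2_eq_square mult_ac)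
  qed
  have term_le: "(if ?W = \<infinity> then \<infinity> else ennreal (dev_term a b (enn2real ?W / enn2real ?\<kappa>))) \<le> ennreal I"
    if ly: "lyapunov_cond lam nu u \<epsilon> \<theta> a b" for \<epsilon> \<theta> a b
  proof -
    have ab: "0 \<le> a" "0 < b" using ly by (auto simp: lyapunov_cond_def)
    define s where "s = sqrt (I * (b + a * I))"
    have s: "0 \<le> s" "s\<^sup>2 = I * (b + a * I)" using ab I0 by (auto simp: s_def)
    have partial: "(\<Sum>x<N. lam x * pmf \<mu> x * u x * \<bar>fdiff ?f x\<bar>) \<le> s" for N
      unfolding s_def
      by (intro real_le_rsqrt weighted_increments_le_information[OF ly _ nu0 _ _ rev mass])
         (use lam energy in \<open>auto simp: less_imp_le pmf_density_nonneg g_def[abs_def]\<close>)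
    have "(\<integral>\<^sup>+ x. ennreal (lam x * u x * \<bar>fdiff ?f x\<bar>) \<partial>measure_pmf \<mu>)
       = (\<Sum>x. ennreal (lam x * pmf \<mu> x * u x * \<bar>fdiff ?f x\<bar>))"
      using lam u_pos by (subst nn_integral_measure_pmf_nat) (auto simp: less_imp_le mult_ac)
    also have "\<dots> \<le> ennreal s"
    proof (intro suminf_le_const)
      fix N
      show "(\<Sum>x<N. ennreal (lam x * pmf \<mu> x * u x * \<bar>fdiff ?f x\<bar>)) \<le> ennreal s"
        using partial[of N] lam u_pos by (subst sum_ennreal) (auto simp: less_imp_le intro!: ennreal_leI)
    qed auto
    finally have "?\<kappa> * (\<integral>\<^sup>+ x. ennreal (lam x * u x * \<bar>fdiff ?f x\<bar>) \<partial>measure_pmf \<mu>) \<le> ?\<kappa> * ennreal s"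
      by (rule mult_left_mono) simp
    hence W: "?W \<le> ?\<kappa> * ennreal s"
      using weighted_isoperimetry[OF irr rec mu rho u fin ac] by (rule order_trans[rotated])
    obtain k where k: "?\<kappa> = ennreal k" "0 < k"
      using fin kappa_u_pos[of lam nu u, OF irr u_pos] by (cases ?\<kappa>) auto
    have W': "?W \<le> ennreal (k * s)" using W k s by (simp add: ennreal_mult)
    hence Wfin: "?W \<noteq> \<infinity>" by (auto simp: top_unique)
    have "enn2real ?W \<le> k * s" using W' k s by (intro enn2real_leI) auto
    hence "enn2real ?W / k \<le> s" using k by (simp add: divide_le_eq mult.commute)
    hence "(enn2real ?W / k)\<^sup>2 \<le> s\<^sup>2" using k by (intro power_mono) auto
    hence "dev_term a b (enn2real ?W / k) \<le> I" using ab I0 s by (intro dev_term_le) auto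
    thus ?thesis using Wfin k by (simp add: ennreal_leI)
  qed
  show ?thesis unfolding info deviation_def
    by (rule SUP_least) (use term_le in auto)
qed

theorem corollary3p9:
  fixes lam nu rho u :: "nat \<Rightarrow> real"
    and du :: "nat \<Rightarrow> nat \<Rightarrow> real"
    and \<mu> :: "nat pmf"
    and \<kappa> :: ennreal
  assumes irreducible: "bd_irreducible lam nu"
    and nonexplosive: "bd_nonexplosive lam nu"
    and positive_recurrent: "bd_positive_recurrent lam nu"
    and mu: "\<mu> = bd_stationary lam nu"
    and rho_pos: "\<forall>x. 0 < rho x"
    and rho_increasing: "strict_mono rho"
    and rho_dom: "rho \<in> dirichlet_dom lam \<mu>"
    and u: "u = (\<lambda>x. rho (x + 1) - rho x)"
    and du: "du = (\<lambda>x y. \<bar>rho x - rho y\<bar>)"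
    and u_integrable: "\<forall>x. \<forall>t\<ge>0. bd_semigroup (birth_u lam u) (death_u nu u) t
          (\<lambda>y. birth_u lam u y + death_u nu u y + \<bar>potential_u lam nu u y\<bar>) x < \<infinity>"
    and du_integrable: "\<forall>x x0. \<forall>t\<ge>0. summable (\<lambda>y. du y x0 * bd_trans lam nu t x y)"
    and V_bounded_below: "bdd_below (range (potential_u lam nu u))"
    and kappa: "\<kappa> = kappa_u lam nu u"
    and kappa_finite: "\<kappa> < \<infinity>"
  shows "(\<forall>\<pi>. absolutely_continuous (measure_pmf \<mu>) (measure_pmf \<pi>) \<and>
              pmf_density \<mu> \<pi> \<in> dirichlet_dom lam \<mu> \<longrightarrow>
              1 / \<kappa> * wasserstein du \<pi> \<mu>
                \<le> (\<integral>\<^sup>+ x. ennreal (lam x * u x * \<bar>fdiff (pmf_density \<mu> \<pi>) x\<bar>) \<partial>measure_pmf \<mu>)) \<and>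
         ((\<exists>\<epsilon> \<theta> a b. lyapunov_cond lam nu u \<epsilon> \<theta> a b) \<longrightarrow>
           (\<forall>\<pi>. absolutely_continuous (measure_pmf \<mu>) (measure_pmf \<pi>) \<longrightarrow>
              deviation lam nu u (wasserstein du \<pi> \<mu>) \<le> fdv_information lam \<pi> \<mu>))"
proof (intro conjI impI allI)
  fix \<pi> :: "nat pmf"
  assume "absolutely_continuous (measure_pmf \<mu>) (measure_pmf \<pi>) \<and> pmf_density \<mu> \<pi> \<in> dirichlet_dom lam \<mu>"
  hence ac: "absolutely_continuous (measure_pmf \<mu>) (measure_pmf \<pi>)" ..
  let ?R = "\<integral>\<^sup>+ x. ennreal (lam x * u x * \<bar>fdiff (pmf_density \<mu> \<pi>) x\<bar>) \<partial>measure_pmf \<mu>"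
  have u_pos: "0 < u x" for x using strict_monoD[OF rho_increasing, of x "x + 1"] by (simp add: u)
  have k: "0 < \<kappa>" "\<kappa> < \<infinity>"
    using kappa_u_pos[of lam nu u, OF irreducible u_pos] kappa kappa_finite by auto
  have "wasserstein du \<pi> \<mu> \<le> \<kappa> * ?R"
    unfolding du kappa
    using kappa kappa_finite
    by (intro weighted_isoperimetry[OF irreducible positive_recurrent mu rho_increasing u _ ac]) simp
  hence "1 / \<kappa> * wasserstein du \<pi> \<mu> \<le> 1 / \<kappa> * (\<kappa> * ?R)"
    by (rule mult_left_mono) simp
  also have "\<dots> = (1 / \<kappa> * \<kappa>) * ?R" by (simp only: mult.assoc)
  also have "1 / \<kappa> * \<kappa> = 1"
    using k by (simp add: ennreal_divide_times ennreal_divide_self)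
  finally show "1 / \<kappa> * wasserstein du \<pi> \<mu> \<le> ?R" by simp
next
  fix \<pi> :: "nat pmf"
  assume "absolutely_continuous (measure_pmf \<mu>) (measure_pmf \<pi>)"
  thus "deviation lam nu u (wasserstein du \<pi> \<mu>) \<le> fdv_information lam \<pi> \<mu>"
    unfolding du using kappa kappa_finite
    by (intro transport_information[OF irreducible positive_recurrent mu rho_increasing u]) simp_all
qed

end
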